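(* Let $\mathcal{S}$ be a timed system with finite set of clocks $X$, and let $\mathrm{STCW}(\mathcal{S})$ be the set of simple words with timing constraints generated by $\mathcal{S}$. Then every word in $\mathrm{STCW}(\mathcal{S})$ has split-width at most $K$, where (1) $K=|X|+4$ if $\mathcal{S}$ is a timed automaton; (2) $K=4|X|+6$ if $\mathcal{S}$ is a timed pushdown automaton (TPDA).
   Context: Fix a finite alphabet $\Sigma$, put $\Sigma_\varepsilon=\Sigma\cup\{\varepsilon\}$, and let $\mathcal{I}$ be a finite set of closed intervals $[c,d]$ with $c\in\mathbb{N}$, $d\in\mathbb{N}\cup\{\infty\}$, containing $[0,0]$. **TCW.** A word with timing constraints (TCW) is $\mathcal{V}=(V,\to,(\curvearrowright^I)_{I\in\mathcal{I}},\lambda)$ where $V$ is a finite set, $\lambda:V\to\Sigma_\varepsilon$, $\leq\;=\;\to^*$ is a total order on $V$ whose direct-successor relation is $\to$, and $\curvearrowright^I\subseteq{<}$ for each $I$ (pairs carrying timing constraint $I$). Write $\curvearrowright=\bigcup_I\curvearrowright^I$. It is simple (STCW) if each position is an endpoint (source or target) of at most one timing constraint. **TPDA.** A TPDA is $\mathcal{S}=(S,s_0,\Sigma,\Gamma,\Delta,X,F)$: finite states $S$, initial state $s_0$, stack alphabet $\Gamma$, clocks $X$, final states $F\subseteq S$, and finitely many transitions $(s,\gamma,a,op,R,s')$ with $s,s'\in S$, $a\in\Sigma$, $\gamma$ a finite conjunction of atoms $x\in I$ ($x\in X$, $I\in\mathcal{I}$), $R\subseteq X$ the clocks reset, and $op$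 one of: $\mathsf{nop}$; $\downarrow_c$ (push $c\in\Gamma$ with age 0); $\uparrow_c^I$ (pop the top symbol if it is $c$ with age in $I$). A timed automaton is a TPDA using only $\mathsf{nop}$. **STCW semantics.** An STCW $\mathcal{V}$ is generated by $\mathcal{S}$ if there is a sequence of transitions $\delta_i=(s_{i-1},\gamma_i,a_i,op_i,R_i,s_i)$, $1\le i\le n$, with $s_n\in F$, such that: - the push/pop sequence $op_1\cdots op_n$ is well-nested (in every prefix #pops $\le$ #pushes, with equality for the whole sequence), and matching pushes and pops carry the same stack symbol; - $V=V_0\uplus\cdots\uplus V_n$ with $V_i$ entirely before $V_j$ for $i<j$. For $i\ge1$, $V_i$ is a sequence $\ell_i\to\ell_i^1\to\cdots\to\ell_i^{h_i}\to p_i\to r_i^1\to\cdots\to r_i^{g_i}\to r_i$, where $h_i$ is the number of conjuncts of $\gamma_i$, $\lambda(p_i)=a_i$ and all other points are labelled $\varepsilon$. With $R_0=X$, $V_0$ is $\ell_0\to r_0^1\to\cdots\to r_0^{g_0}\to r_0$, all labelled $\varepsilon$. Here $g_i\ge0$ is the number of timing constraints starting from clocks reset in step $i$ and checked later; - for each $I$, $\curvearrowright^I=\curvearrowright^{s\in I}\uplus\biguplus_{x\in X\cup\{\zeta\}}\curvearrowright^{x\in I}$ ($\zeta\notin X$ an extra clock), where: the $\zeta$-constraints are exactly the pairs $(\ell_i,r_i)$, $0\le i\le n$, with interval $[0,0]$; $p_i\curvearrowright^{s\in I}p_j$ iff $op_i=\downarrow_b$ and $op_j=\uparrow_b^I$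 is its matching pop; for $x\in X$, whenever $0\le i<j\le n$, the $t$-th conjunct of $\gamma_j$ is $x\in I$, $x\in R_i$ and $x\notin R_k$ for $i<k<j$, there is $1\le s\le g_i$ with $r_i^s\curvearrowright^{x\in I}\ell_j^t$, and all $x$-constraints arise this way. Every $r_i^s$ is the source of a constraint for some clock in $R_i$. Writing $\curvearrowright^x=\bigcup_I\curvearrowright^{x\in I}$, within each $V_i$ the points $r_i^1,\dots,r_i^{g_i}$ are grouped by clock (if $s<u<t$ and $r_i^s,r_i^t\in\mathrm{dom}(\curvearrowright^x)$ then $r_i^u\in\mathrm{dom}(\curvearrowright^x)$), and for $u\curvearrowright^xv$, $u'\curvearrowright^xv'$ with $u,u'\in V_i$ and $u<u'$ one has $u'<v'<v$. $\mathrm{STCW}(\mathcal{S})$ is the set of STCWs generated by $\mathcal{S}$. **Split-width.** A split-TCW is a TCW in which the successor relation is partitioned into present edges $\to$ and absent edges (holes) $\dashrightarrow$. Blocks are maximal sets of points connected by $\to$; the width is the number of blocks. A TCW is a split-TCW of width 1. A split-TCW is atomic if it is a single point, or two points $p_1\dashrightarrow p_2$ with one timing constraint $p_1\curvearrowright^Ip_2$. "Connected" means connected with respect to $\to\cup\curvearrowright$. A split-tree for $\mathcal{V}$ is a finite binary tree labelled by split-TCWs such that: the root is labelled $\mathcal{V}$; leaves are labelled by atomic split-TCWs; a unary node is labelled by a connected split-TCW and its child by the split-TCW obtained by turning one $\to$ edge into a hole; a binary node is labelled by a disconnected split-TCW which is the disjoint union $\mathcal{V}_1\uplus\mathcal{V}_2$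 of the labels of its children (each $\mathcal{V}_i$ being a union of connected components with the inherited order, consecutive blocks being separated by holes). The width of a split-tree is the maximum width of its labels; the split-width of a simple (split-)TCW is the minimum width of a split-tree for it. *)

theory Defs
  imports "HOL-Library.Extended_Nat" "HOL-Library.Disjoint_Sets"
begin

section \<open>Words with timing constraints\<close>

text \<open>The pair \<open>(c, d)\<close> stands for the closed interval \<open>[c, d]\<close>, with \<open>d = \<infinity>\<close> for
  an unbounded one.  Intervals act as labels only, so \<open>c \<le> d\<close> is not required.\<close>

type_synonym interval = "nat \<times> enat"

text \<open>One record serves for words with timing constraints and for their split versions: the
  successor relation is \<open>step\<close> (present edges) together with \<open>hole\<close> (absent edges).
  \<open>tc W I\<close> are the pairs carrying the timing constraint \<open>I\<close>; the label \<open>None\<close> is the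
  empty word.\<close>

record ('v, 'a) split_tcw =
  points :: "'v set"
  step :: "('v \<times> 'v) set"
  hole :: "('v \<times> 'v) set"
  tc :: "interval \<Rightarrow> ('v \<times> 'v) set"
  label :: "'v \<Rightarrow> 'a option"

definition le :: "('v, 'a) split_tcw \<Rightarrow> ('v \<times> 'v) set" where
  "le W = Restr ((step W \<union> hole W)\<^sup>*) (points W)"

definition lt :: "('v, 'a) split_tcw \<Rightarrow> ('v \<times> 'v) set" where
  "lt W = le W - Id"

definition direct_succ :: "'v set \<Rightarrow> ('v \<times> 'v) set \<Rightarrow> ('v \<times> 'v) set" where
  "direct_succ U r =
     {(u, v). u \<in> U \<and> v \<in> U \<and> (u, v) \<in> r \<and> \<not> (\<exists>w\<in>U. (u, w) \<in> r \<and> (w, v) \<in> r)}"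

definition is_split_tcw :: "'a set \<Rightarrow> interval set \<Rightarrow> ('v, 'a) split_tcw \<Rightarrow> bool" where
  "is_split_tcw Sig Is W \<longleftrightarrow>
     finite (points W) \<and>
     label W ` points W \<subseteq> insert None (Some ` Sig) \<and>
     linear_order_on (points W) (le W) \<and>
     step W \<union> hole W = direct_succ (points W) (lt W) \<and>
     step W \<inter> hole W = {} \<and>
     (\<forall>I\<in>Is. tc W I \<subseteq> lt W) \<and>
     (\<forall>I. I \<notin> Is \<longrightarrow> tc W I = {})"

definition is_tcw :: "'a set \<Rightarrow> interval set \<Rightarrow> ('v, 'a) split_tcw \<Rightarrow> bool" where
  "is_tcw Sig Is W \<longleftrightarrow> is_split_tcw Sig Is W \<and> hole W = {}"

definition simple :: "('v, 'a) split_tcw \<Rightarrow> bool" where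
  "simple W \<longleftrightarrow>
     (\<forall>I J u v u' v'. (u, v) \<in> tc W I \<and> (u', v') \<in> tc W J \<and> {u, v} \<inter> {u', v'} \<noteq> {} \<longrightarrow>
        I = J \<and> u = u' \<and> v = v')"

definition is_stcw :: "'a set \<Rightarrow> interval set \<Rightarrow> ('v, 'a) split_tcw \<Rightarrow> bool" where
  "is_stcw Sig Is W \<longleftrightarrow> is_tcw Sig Is W \<and> simple W"


section \<open>Split-width\<close>

definition block_of :: "('v, 'a) split_tcw \<Rightarrow> 'v \<Rightarrow> 'v set" where
  "block_of W v = {u \<in> points W. (v, u) \<in> (step W \<union> (step W)\<inverse>)\<^sup>*}"

definition width :: "('v, 'a) split_tcw \<Rightarrow> nat" where
  "width W = card (block_of W ` points W)"

definition link :: "('v, 'a) split_tcw \<Rightarrow> ('v \<times> 'v) set" where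
  "link W = step W \<union> (\<Union>I. tc W I)"

definition component_of :: "('v, 'a) split_tcw \<Rightarrow> 'v \<Rightarrow> 'v set" where
  "component_of W v = {u \<in> points W. (v, u) \<in> (link W \<union> (link W)\<inverse>)\<^sup>*}"

definition connected_word :: "('v, 'a) split_tcw \<Rightarrow> bool" where
  "connected_word W \<longleftrightarrow> (\<forall>v\<in>points W. component_of W v = points W)"

definition atomic :: "('v, 'a) split_tcw \<Rightarrow> bool" where
  "atomic W \<longleftrightarrow>
     (\<exists>p. points W = {p}) \<or>
     (\<exists>p q I. p \<noteq> q \<and> points W = {p, q} \<and> step W = {} \<and> hole W = {(p, q)} \<and>
        tc W = (\<lambda>J. if J = I then {(p, q)} else {}))"

definition cut :: "('v, 'a) split_tcw \<Rightarrow> 'v \<times> 'v \<Rightarrow> ('v, 'a) split_tcw" where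
  "cut W e = W\<lparr>step := step W - {e}, hole := insert e (hole W)\<rparr>"

text \<open>The order is inherited; two points that become consecutive without being joined by a
  present edge are separated by a hole.\<close>

definition induced :: "('v, 'a) split_tcw \<Rightarrow> 'v set \<Rightarrow> ('v, 'a) split_tcw" where
  "induced W U =
     \<lparr>points = U,
      step = Restr (step W) U,
      hole = direct_succ U (lt W) - step W,
      tc = (\<lambda>I. Restr (tc W I) U),
      label = label W\<rparr>"

definition union_of_components :: "('v, 'a) split_tcw \<Rightarrow> 'v set \<Rightarrow> bool" where
  "union_of_components W U \<longleftrightarrow> U \<subseteq> points W \<and> (\<forall>v\<in>U. component_of W v \<subseteq> U)"

definition disjoint_union_of ::
  "('v, 'a) split_tcw \<Rightarrow> ('v, 'a) split_tcw \<Rightarrow> ('v, 'a) split_tcw \<Rightarrow> bool" where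
  "disjoint_union_of W W1 W2 \<longleftrightarrow>
     (\<exists>U1 U2. U1 \<noteq> {} \<and> U2 \<noteq> {} \<and> U1 \<inter> U2 = {} \<and> U1 \<union> U2 = points W \<and>
        union_of_components W U1 \<and> union_of_components W U2 \<and>
        W1 = induced W U1 \<and> W2 = induced W U2)"

datatype 'w split_tree =
    Leaf (root: 'w)
  | Unary (root: 'w) "'w split_tree"
  | Binary (root: 'w) "'w split_tree" "'w split_tree"

primrec is_split_tree ::
  "'a set \<Rightarrow> interval set \<Rightarrow> ('v, 'a) split_tcw split_tree \<Rightarrow> bool" where
  "is_split_tree Sig Is (Leaf W) \<longleftrightarrow> is_split_tcw Sig Is W \<and> atomic W"
| "is_split_tree Sig Is (Unary W t) \<longleftrightarrow>
     is_split_tcw Sig Is W \<and> connected_word W \<and>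
     (\<exists>e\<in>step W. root t = cut W e) \<and> is_split_tree Sig Is t"
| "is_split_tree Sig Is (Binary W t1 t2) \<longleftrightarrow>
     is_split_tcw Sig Is W \<and> \<not> connected_word W \<and>
     disjoint_union_of W (root t1) (root t2) \<and>
     is_split_tree Sig Is t1 \<and> is_split_tree Sig Is t2"

definition tree_width :: "('v, 'a) split_tcw split_tree \<Rightarrow> nat" where
  "tree_width t = Max (width ` set_split_tree t)"

text \<open>An infimum in \<open>enat\<close>, so that a word without any split-tree would get \<open>\<infinity>\<close>.\<close>

definition split_width :: "'a set \<Rightarrow> interval set \<Rightarrow> ('v, 'a) split_tcw \<Rightarrow> enat" where
  "split_width Sig Is W =
     Inf {enat (tree_width t) | t. is_split_tree Sig Is t \<and> root t = W}"


section \<open>Timed pushdown automata\<close>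

datatype 'c stack_op = Nop | Push 'c | Pop 'c interval

text \<open>A guard is the list of the conjuncts \<open>x \<in> I\<close>.\<close>

record ('s, 'a, 'c, 'x) transition =
  source :: 's
  guard :: "('x \<times> interval) list"
  letter :: 'a
  act :: "'c stack_op"
  resets :: "'x set"
  target :: 's

record ('s, 'a, 'c, 'x) tpda =
  states :: "'s set"
  init :: 's
  alphabet :: "'a set"
  stack_syms :: "'c set"
  transitions :: "('s, 'a, 'c, 'x) transition set"
  clocks :: "'x set"
  finals :: "'s set"

fun valid_op :: "interval set \<Rightarrow> 'c set \<Rightarrow> 'c stack_op \<Rightarrow> bool" where
  "valid_op Is G Nop \<longleftrightarrow> True"
| "valid_op Is G (Push c) \<longleftrightarrow> c \<in> G"
| "valid_op Is G (Pop c I) \<longleftrightarrow> c \<in> G \<and> I \<in> Is"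

definition is_tpda :: "interval set \<Rightarrow> ('s, 'a, 'c, 'x) tpda \<Rightarrow> bool" where
  "is_tpda Is S \<longleftrightarrow>
     finite (states S) \<and> init S \<in> states S \<and> finals S \<subseteq> states S \<and>
     finite (alphabet S) \<and> finite (stack_syms S) \<and> finite (clocks S) \<and>
     finite (transitions S) \<and>
     (\<forall>d\<in>transitions S.
        source d \<in> states S \<and> target d \<in> states S \<and> letter d \<in> alphabet S \<and>
        set (guard d) \<subseteq> clocks S \<times> Is \<and> resets d \<subseteq> clocks S \<and>
        valid_op Is (stack_syms S) (act d))"

definition is_timed_automaton :: "('s, 'a, 'c, 'x) tpda \<Rightarrow> bool" where
  "is_timed_automaton S \<longleftrightarrow> (\<forall>d\<in>transitions S. act d = Nop)"


section \<open>The words generated by a system\<close>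

text \<open>A sequence of \<open>n\<close> transitions is a function \<open>d\<close> used at the arguments \<open>1, \<dots>, n\<close>;
  \<open>q 0, \<dots>, q n\<close> are the visited states.\<close>

definition is_run ::
  "('s, 'a, 'c, 'x) tpda \<Rightarrow> nat \<Rightarrow> (nat \<Rightarrow> 's) \<Rightarrow> (nat \<Rightarrow> ('s, 'a, 'c, 'x) transition) \<Rightarrow> bool"
where
  "is_run S n q d \<longleftrightarrow>
     q 0 = init S \<and> q n \<in> finals S \<and>
     (\<forall>i\<in>{1..n}. d i \<in> transitions S \<and> source (d i) = q (i - 1) \<and> target (d i) = q i)"

definition pushes :: "(nat \<Rightarrow> 'c stack_op) \<Rightarrow> nat \<Rightarrow> nat \<Rightarrow> nat" where
  "pushes ops i j = card {k. i < k \<and> k \<le> j \<and> (\<exists>c. ops k = Push c)}"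

definition pops :: "(nat \<Rightarrow> 'c stack_op) \<Rightarrow> nat \<Rightarrow> nat \<Rightarrow> nat" where
  "pops ops i j = card {k. i < k \<and> k \<le> j \<and> (\<exists>c I. ops k = Pop c I)}"

text \<open>\<open>well_nested ops i j\<close> concerns the operations number \<open>i + 1, \<dots>, j\<close>.\<close>

definition well_nested :: "(nat \<Rightarrow> 'c stack_op) \<Rightarrow> nat \<Rightarrow> nat \<Rightarrow> bool" where
  "well_nested ops i j \<longleftrightarrow>
     (\<forall>k. i \<le> k \<and> k \<le> j \<longrightarrow> pops ops i k \<le> pushes ops i k) \<and> pops ops i j = pushes ops i j"

definition matching :: "(nat \<Rightarrow> 'c stack_op) \<Rightarrow> nat \<Rightarrow> nat \<Rightarrow> bool" where
  "matching ops i j \<longleftrightarrow>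
     i < j \<and> (\<exists>b. ops i = Push b) \<and> (\<exists>c I. ops j = Pop c I) \<and> well_nested ops i (j - 1)"

definition stack_ok :: "nat \<Rightarrow> (nat \<Rightarrow> 'c stack_op) \<Rightarrow> bool" where
  "stack_ok n ops \<longleftrightarrow>
     well_nested ops 0 n \<and>
     (\<forall>i j b c I. 1 \<le> i \<and> j \<le> n \<and> matching ops i j \<and> ops i = Push b \<and> ops j = Pop c I \<longrightarrow> b = c)"

text \<open>Names for the points of the factors \<open>V\<^sub>0, \<dots>, V\<^sub>n\<close> of a generated word:
  \<open>lpt i\<close> is \<open>\<ell>\<^sub>i\<close>, \<open>cpt i t\<close> is the point of the conjunct number \<open>t\<close>,
  \<open>ppt i\<close> is \<open>p\<^sub>i\<close> (for \<open>i \<ge> 1\<close>), \<open>spt i s\<close> for \<open>s < num_src i\<close> are the sources of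
  the clock constraints, and \<open>rpt i\<close> is \<open>r\<^sub>i\<close>.  The second indices start at \<open>0\<close>.\<close>

record 'v layout =
  lpt :: "nat \<Rightarrow> 'v"
  cpt :: "nat \<Rightarrow> nat \<Rightarrow> 'v"
  ppt :: "nat \<Rightarrow> 'v"
  spt :: "nat \<Rightarrow> nat \<Rightarrow> 'v"
  rpt :: "nat \<Rightarrow> 'v"
  num_src :: "nat \<Rightarrow> nat"

definition factor ::
  "(nat \<Rightarrow> ('s, 'a, 'c, 'x) transition) \<Rightarrow> 'v layout \<Rightarrow> nat \<Rightarrow> 'v list" where
  "factor d P i =
     [lpt P i] @
     (if i = 0 then [] else map (cpt P i) [0..<length (guard (d i))] @ [ppt P i]) @
     map (spt P i) [0..<num_src P i] @ [rpt P i]"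

definition resets_at ::
  "('s, 'a, 'c, 'x) tpda \<Rightarrow> (nat \<Rightarrow> ('s, 'a, 'c, 'x) transition) \<Rightarrow> nat \<Rightarrow> 'x set" where
  "resets_at S d i = (if i = 0 then clocks S else resets (d i))"

text \<open>\<open>x\<close> is last reset before step \<open>j\<close> in step \<open>i\<close>, and conjunct number \<open>t\<close> of step
  \<open>j\<close> is \<open>x \<in> I\<close>.\<close>

definition checked ::
  "('s, 'a, 'c, 'x) tpda \<Rightarrow> nat \<Rightarrow> (nat \<Rightarrow> ('s, 'a, 'c, 'x) transition) \<Rightarrow>
   nat \<Rightarrow> nat \<Rightarrow> nat \<Rightarrow> 'x \<Rightarrow> interval \<Rightarrow> bool" where
  "checked S n d i j t x I \<longleftrightarrow>
     i < j \<and> j \<le> n \<and> t < length (guard (d j)) \<and> guard (d j) ! t = (x, I) \<and>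
     x \<in> resets_at S d i \<and> (\<forall>k. i < k \<and> k < j \<longrightarrow> x \<notin> resets_at S d k)"

text \<open>The origin of a timing constraint; \<open>Zeta\<close> is the extra clock outside \<open>clocks S\<close>.\<close>

datatype 'x origin = Stack | Zeta | Clock 'x

definition factorised ::
  "nat \<Rightarrow> (nat \<Rightarrow> ('s, 'a, 'c, 'x) transition) \<Rightarrow> 'v layout \<Rightarrow> ('v, 'a) split_tcw \<Rightarrow> bool" where
  "factorised n d P W \<longleftrightarrow>
     points W = (\<Union>i\<le>n. set (factor d P i)) \<and>
     (\<forall>i j. i < j \<and> j \<le> n \<longrightarrow> set (factor d P i) \<times> set (factor d P j) \<subseteq> lt W) \<and>
     (\<forall>i\<le>n. successively (\<lambda>u v. (u, v) \<in> step W) (factor d P i)) \<and>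
     (\<forall>i\<in>{1..n}. label W (ppt P i) = Some (letter (d i))) \<and>
     (\<forall>v\<in>points W - ppt P ` {1..n}. label W v = None)"

definition stack_constraints ::
  "nat \<Rightarrow> (nat \<Rightarrow> ('s, 'a, 'c, 'x) transition) \<Rightarrow> 'v layout \<Rightarrow> interval \<Rightarrow> ('v \<times> 'v) set" where
  "stack_constraints n d P I =
     {(ppt P i, ppt P j) | i j. 1 \<le> i \<and> j \<le> n \<and> matching (\<lambda>k. act (d k)) i j \<and>
        (\<exists>b. act (d i) = Push b \<and> act (d j) = Pop b I)}"

definition zeta_constraints :: "nat \<Rightarrow> 'v layout \<Rightarrow> interval \<Rightarrow> ('v \<times> 'v) set" where
  "zeta_constraints n P I = (if I = (0, 0) then {(lpt P i, rpt P i) | i. i \<le> n} else {})"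

text \<open>Here \<open>C I\<close> are the constraints of the clock \<open>x\<close> with interval \<open>I\<close>.\<close>

definition clock_constraints_ok ::
  "('s, 'a, 'c, 'x) tpda \<Rightarrow> nat \<Rightarrow> (nat \<Rightarrow> ('s, 'a, 'c, 'x) transition) \<Rightarrow> 'v layout \<Rightarrow>
   ('v, 'a) split_tcw \<Rightarrow> 'x \<Rightarrow> (interval \<Rightarrow> ('v \<times> 'v) set) \<Rightarrow> bool" where
  "clock_constraints_ok S n d P W x C \<longleftrightarrow>
     (\<forall>i j t I. checked S n d i j t x I \<longrightarrow> (\<exists>s<num_src P i. (spt P i s, cpt P j t) \<in> C I)) \<and>
     (\<forall>I. C I \<subseteq> {(spt P i s, cpt P j t) | i j s t. s < num_src P i \<and> checked S n d i j t x I}) \<and>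
     (\<forall>i\<le>n. \<forall>s u t. s < u \<and> u < t \<and> t < num_src P i \<and>
        spt P i s \<in> Domain (\<Union>I. C I) \<and> spt P i t \<in> Domain (\<Union>I. C I) \<longrightarrow>
        spt P i u \<in> Domain (\<Union>I. C I)) \<and>
     (\<forall>i\<le>n. \<forall>u u' v v'. (u, v) \<in> (\<Union>I. C I) \<and> (u', v') \<in> (\<Union>I. C I) \<and>
        u \<in> set (factor d P i) \<and> u' \<in> set (factor d P i) \<and> (u, u') \<in> lt W \<longrightarrow>
        (u', v') \<in> lt W \<and> (v', v) \<in> lt W)"

definition constraints_ok ::
  "('s, 'a, 'c, 'x) tpda \<Rightarrow> nat \<Rightarrow> (nat \<Rightarrow> ('s, 'a, 'c, 'x) transition) \<Rightarrow> 'v layout \<Rightarrow>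
   ('v, 'a) split_tcw \<Rightarrow> ('x origin \<Rightarrow> interval \<Rightarrow> ('v \<times> 'v) set) \<Rightarrow> bool" where
  "constraints_ok S n d P W C \<longleftrightarrow>
     (\<forall>I. tc W I = (\<Union>z\<in>{Stack, Zeta} \<union> Clock ` clocks S. C z I) \<and>
          disjoint_family_on (\<lambda>z. C z I) ({Stack, Zeta} \<union> Clock ` clocks S)) \<and>
     C Stack = stack_constraints n d P \<and>
     C Zeta = zeta_constraints n P \<and>
     (\<forall>x\<in>clocks S. clock_constraints_ok S n d P W x (C (Clock x))) \<and>
     (\<forall>i\<le>n. \<forall>s<num_src P i. \<exists>x\<in>resets_at S d i. spt P i s \<in> Domain (\<Union>I. C (Clock x) I))"

definition generated :: "('s, 'a, 'c, 'x) tpda \<Rightarrow> ('v, 'a) split_tcw \<Rightarrow> bool" where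
  "generated S W \<longleftrightarrow>
     (\<exists>n q d P C. is_run S n q d \<and> stack_ok n (\<lambda>k. act (d k)) \<and>
        factorised n d P W \<and> constraints_ok S n d P W C)"

definition STCW :: "interval set \<Rightarrow> ('s, 'a, 'c, 'x) tpda \<Rightarrow> ('v, 'a) split_tcw set" where
  "STCW Is S = {W. is_stcw (alphabet S) Is W \<and> generated S W}"

end

theory Submission
  imports Defs
begin

text \<open>
  Number the points by \<open>0, \<dots>, N - 1\<close> and let every constraint end at its target, every
  unconstrained point at itself.  For \<open>a \<le> m\<close> the points whose constraint ends in
  \<open>[a, m)\<close> form a set \<open>U a m\<close> closed under constraints.  As the constraints of a clock
  starting in one factor are grouped and nested, each clock crossing an end of \<open>[a, m)\<close> creates at
  most one further block of \<open>U a m\<close> at that end, and so does the extra clock.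

  Without a stack, peel off the last point of \<open>U 0 m\<close> together with its source: \<open>U 0 m\<close> has at most
  \<open>|X| + 2\<close> blocks and the removed part at most two.  With a stack, keep \<open>a\<close> at the beginning of a
  factor and let at most one stack constraint leave \<open>[a, m)\<close> and none enter, so that \<open>U a m\<close> has at
  most \<open>2 |X| + 3\<close> blocks.  If the last point is a pop and a stack constraint leaves already,
  then split at the factor of the matching push, which costs \<open>2 (2 |X| + 3)\<close>; otherwise
  peel.
\<close>

section \<open>Building split-trees\<close>

text \<open>Since \<open>le\<close> is a closure of \<open>step\<close> and \<open>hole\<close>, the
  order of an induced word must be recovered from direct successors alone. On a finite set this
  follows by induction on the number of points strictly between \<open>u\<close> and
  \<open>v\<close>: any such point splits the pair into two pairs with fewer points between
  them.\<close>

lemma direct_succ_rtrancl: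
  assumes "finite U" "U \<subseteq> A" "linear_order_on A r"
  shows "Restr ((direct_succ U (r - Id))\<^sup>*) U = Restr r U"
proof (intro equalityI subrelI)
  have tr: "trans r" and rf: "refl_on A r" and an: "antisym r"
    using assms(3) by (auto simp: order_on_defs)
  fix u v
  show "(u, v) \<in> Restr r U" if "(u, v) \<in> Restr ((direct_succ U (r - Id))\<^sup>*) U"
  proof -
    have "(u, v) \<in> (direct_succ U (r - Id))\<^sup>*" "u \<in> U" "v \<in> U" using that by auto
    then show ?thesis
    proof (induction rule: rtrancl_induct)
      case base
      then show ?case using rf assms(2) by (auto simp: refl_on_def)
    next
      case (step y z)
      then show ?case using tr by (auto simp: direct_succ_def dest: transD)
    qed
  qed
  have "(u, v) \<in> r \<Longrightarrow> u \<in> U \<Longrightarrow> v \<in> U \<Longrightarrow> (u, v) \<in> (direct_succ U (r - Id))\<^sup>*"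
  proof (induction "card {w \<in> U. (u, w) \<in> r - Id \<and> (w, v) \<in> r - Id}" arbitrary: u v rule: less_induct)
    case less
    let ?B = "\<lambda>u v. {w \<in> U. (u, w) \<in> r - Id \<and> (w, v) \<in> r - Id}"
    have fin: "finite (?B u v)" using assms(1) by simp
    show ?case
    proof (cases "u = v \<or> ?B u v = {}")
      case True
      then show ?thesis
      proof
        assume "?B u v = {}"
        then have "u \<noteq> v \<Longrightarrow> (u, v) \<in> direct_succ U (r - Id)"
          using less.prems by (auto simp: direct_succ_def)
        then show ?thesis by (cases "u = v") auto
      qed simp
    next
      case False
      then obtain w where w: "w \<in> U" "(u, w) \<in> r - Id" "(w, v) \<in> r - Id" by blast
      have 1: "?B u w \<subseteq> ?B u v - {w}" and 2: "?B w v \<subseteq> ?B u v - {w}"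
        using w tr an by (auto dest: transD antisymD)
      have "card (?B u v - {w}) < card (?B u v)" using w fin by (intro card_Diff1_less) auto
      then have "card (?B u w) < card (?B u v)" "card (?B w v) < card (?B u v)"
        using card_mono[OF _ 1] card_mono[OF _ 2] fin by (auto intro: le_less_trans)
      then have "(u, w) \<in> (direct_succ U (r - Id))\<^sup>*" "(w, v) \<in> (direct_succ U (r - Id))\<^sup>*"
        using less.hyps less.prems w by auto
      then show ?thesis by (rule rtrancl_trans)
    qed
  qed
  then show "(u, v) \<in> Restr ((direct_succ U (r - Id))\<^sup>*) U" if "(u, v) \<in> Restr r U"
    using that by auto
qed

lemma direct_succ_Restr: "direct_succ U (Restr r U) = direct_succ U r"
  by (auto simp: direct_succ_def)

lemma direct_succ_subset: "direct_succ U r \<subseteq> U \<times> U"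
  by (auto simp: direct_succ_def)

lemma direct_succ_mono: "V \<subseteq> U \<Longrightarrow> Restr (direct_succ U r) V \<subseteq> direct_succ V r"
  by (auto simp: direct_succ_def)

lemma linear_order_on_Restr_subset:
  "linear_order_on A r \<Longrightarrow> U \<subseteq> A \<Longrightarrow> linear_order_on U (Restr r U)"
  by (simp add: order_on_defs trans_Restr antisym_Restr refl_on_def total_on_def subset_eq)

section \<open>Induced words and cut edges\<close>

lemma induced_sel [simp]:
  "points (induced W U) = U" "step (induced W U) = Restr (step W) U"
  "hole (induced W U) = direct_succ U (lt W) - step W"
  "tc (induced W U) = (\<lambda>I. Restr (tc W I) U)" "label (induced W U) = label W"
  by (simp_all add: induced_def)

lemma cut_sel [simp]:
  "points (cut W e) = points W" "step (cut W e) = step W - {e}" "hole (cut W e) = insert e (hole W)"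
  "tc (cut W e) = tc W" "label (cut W e) = label W"
  by (simp_all add: cut_def)

lemma split_tcw_ext:
  fixes W W' :: "('v, 'a) split_tcw"
  shows "points W = points W' \<Longrightarrow> step W = step W' \<Longrightarrow> hole W = hole W' \<Longrightarrow> tc W = tc W' \<Longrightarrow>
    label W = label W' \<Longrightarrow> W = W'"
  by simp

context
  fixes Sig :: "'a set" and Is :: "interval set" and W :: "('v, 'a) split_tcw"
  assumes W: "is_split_tcw Sig Is W"
begin

lemma split_tcw_finite: "finite (points W)"
  and split_tcw_linear: "linear_order_on (points W) (le W)"
  and split_tcw_succ: "step W \<union> hole W = direct_succ (points W) (lt W)"
  and split_tcw_disj: "step W \<inter> hole W = {}"
  using W by (auto simp: is_split_tcw_def)

lemma tc_subset_lt: "tc W I \<subseteq> lt W"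
  using W by (cases I, cases "I \<in> Is") (auto simp: is_split_tcw_def)

lemma lt_subset: "lt W \<subseteq> points W \<times> points W"
  by (auto simp: lt_def le_def)

lemma step_subset_succ: "step W \<subseteq> direct_succ (points W) (lt W)"
  using split_tcw_succ by auto

lemma step_subset_lt: "step W \<subseteq> lt W"
  using step_subset_succ by (auto simp: direct_succ_def)

lemma link_subset_lt: "link W \<subseteq> lt W"
  using step_subset_lt tc_subset_lt by (auto simp: link_def)

lemma step_hole_induced:
  assumes "U \<subseteq> points W"
  shows "step (induced W U) \<union> hole (induced W U) = direct_succ U (lt W)"
  using direct_succ_mono[OF assms, of "lt W"] step_subset_succ direct_succ_subset[of U "lt W"]
  by fastforce

lemma le_induced: "U \<subseteq> points W \<Longrightarrow> le (induced W U) = Restr (le W) U"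
  using step_hole_induced[of U] direct_succ_rtrancl[OF _ _ split_tcw_linear, of U]
    split_tcw_finite
  by (simp add: le_def[of "induced W U"] finite_subset lt_def)

lemma lt_induced: "U \<subseteq> points W \<Longrightarrow> lt (induced W U) = Restr (lt W) U"
  by (auto simp: lt_def le_induced)

lemma is_split_tcw_induced: "U \<subseteq> points W \<Longrightarrow> is_split_tcw Sig Is (induced W U)"
  using W step_hole_induced[of U] linear_order_on_Restr_subset[OF split_tcw_linear, of U]
  unfolding is_split_tcw_def
  by (auto simp: le_induced lt_induced direct_succ_Restr finite_subset)

lemma is_split_tcw_cut:
  assumes "e \<in> step W"
  shows "is_split_tcw Sig Is (cut W e)" "lt (cut W e) = lt W"
proof -
  have eq: "step W - {e} \<union> insert e (hole W) = step W \<union> hole W" using assms by auto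
  have le: "le (cut W e) = le W" unfolding le_def by (simp only: cut_sel eq)
  then show lt: "lt (cut W e) = lt W" by (simp add: lt_def)
  show "is_split_tcw Sig Is (cut W e)"
    using W unfolding is_split_tcw_def by (simp only: cut_sel eq le lt) auto
qed

lemma induced_induced:
  "V \<subseteq> U \<Longrightarrow> U \<subseteq> points W \<Longrightarrow> induced (induced W U) V = induced W V"
  by (intro split_tcw_ext) (auto simp: lt_induced direct_succ_def fun_eq_iff)

lemma induced_points: "induced W (points W) = W"
  using step_subset_lt tc_subset_lt lt_subset split_tcw_succ split_tcw_disj
  by (intro split_tcw_ext) (simp_all add: fun_eq_iff; blast)+

text \<open>The holes of an induced word are computed from the order and the present edges, not from
  the holes of \<open>W\<close>, so cutting an edge that is not inside \<open>U\<close> leaves no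
  trace.\<close>

lemma induced_cut:
  assumes "e \<in> step W" "e \<notin> U \<times> U"
  shows "induced (cut W e) U = induced W U"
  using assms direct_succ_subset[of U "lt W"]
  by (auto simp: induced_def is_split_tcw_cut)

lemma cut_induced:
  assumes "e \<in> step W" "e \<in> U \<times> U" "U \<subseteq> points W"
  shows "cut (induced W U) e = induced (cut W e) U"
proof -
  have "e \<in> direct_succ U (lt W)"
    using assms direct_succ_mono[OF assms(3), of "lt W"] step_subset_succ by blast
  then show ?thesis
    using assms by (intro split_tcw_ext) (auto simp: is_split_tcw_cut)
qed

end

text \<open>An edgewise form of being a union of components (\<open>union_of_components_iff\<close>)
  that avoids reflexive transitive closures.\<close>

definition link_closed :: "('v, 'a) split_tcw \<Rightarrow> 'v set \<Rightarrow> bool" where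
  "link_closed W U \<longleftrightarrow> U \<subseteq> points W \<and> (\<forall>(u, v)\<in>link W. u \<in> U \<longleftrightarrow> v \<in> U)"

lemma link_induced: "link (induced W U) = Restr (link W) U"
  by (auto simp: link_def)

lemma link_closed_Diff:
  assumes "is_split_tcw Sig Is W" "link_closed W U"
  shows "link_closed W (points W - U)"
  using assms link_subset_lt[OF assms(1)] lt_subset[OF assms(1)] by (fastforce simp: link_closed_def)

lemma union_of_components_iff:
  assumes "is_split_tcw Sig Is W"
  shows "union_of_components W U \<longleftrightarrow> link_closed W U"
proof
  assume U: "union_of_components W U"
  have "u \<in> U \<longleftrightarrow> v \<in> U" if "(u, v) \<in> link W" for u v
  proof -
    have "u \<in> points W" "v \<in> points W"
      using that link_subset_lt[OF assms] lt_subset[OF assms] by auto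
    then have "v \<in> component_of W u" "u \<in> component_of W v"
      using that by (auto simp: component_of_def)
    then show ?thesis using U by (auto simp: union_of_components_def)
  qed
  then show "link_closed W U" using U by (auto simp: link_closed_def union_of_components_def)
next
  assume U: "link_closed W U"
  have "u \<in> U" if "(v, u) \<in> (link W \<union> (link W)\<inverse>)\<^sup>*" "v \<in> U" for u v
    using that by (induction rule: rtrancl_induct) (use U in \<open>auto simp: link_closed_def\<close>)
  then show "union_of_components W U"
    using U by (auto simp: link_closed_def union_of_components_def component_of_def)
qed

text \<open>Turns disconnectedness into the existence of a proper nonempty closed set, which is what
  a binary node needs.\<close>

lemma connected_word_iff:
  assumes "is_split_tcw Sig Is W"
  shows "connected_word W \<longleftrightarrow> (\<forall>U. link_closed W U \<and> U \<noteq> {} \<longrightarrow> U = points W)"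
proof
  assume C: "connected_word W"
  show "\<forall>U. link_closed W U \<and> U \<noteq> {} \<longrightarrow> U = points W"
  proof (intro allI impI)
    fix U assume U: "link_closed W U \<and> U \<noteq> {}"
    then have uc: "union_of_components W U" using union_of_components_iff[OF assms] by auto
    obtain v where "v \<in> U" using U by auto
    then show "U = points W"
      using uc C by (fastforce simp: union_of_components_def connected_word_def)
  qed
next
  assume H: "\<forall>U. link_closed W U \<and> U \<noteq> {} \<longrightarrow> U = points W"
  show "connected_word W"
    unfolding connected_word_def
  proof
    fix v assume v: "v \<in> points W"
    have "union_of_components W (component_of W v)"
      by (auto simp: union_of_components_def component_of_def intro: rtrancl_trans)
    moreover have "v \<in> component_of W v" using v by (auto simp: component_of_def)
    ultimately show "component_of W v = points W"
      using H union_of_components_iff[OF assms] by blast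
  qed
qed

text \<open>Every block has exactly one first point, so the blocks are counted by the points without
  a predecessor along a present edge.\<close>

definition block_starts :: "('v, 'a) split_tcw \<Rightarrow> 'v set" where
  "block_starts W = points W - Range (step W)"

text \<open>Going backwards along present edges stays in the same block and terminates because the
  order is finite; so every block is the block of some start.\<close>

lemma width_le_block_starts:
  assumes "is_split_tcw Sig Is W"
  shows "width W \<le> card (block_starts W)"
proof -
  note lin = split_tcw_linear[OF assms] and fin = split_tcw_finite[OF assms]
  have "finite (lt W)" using lt_subset[OF assms] fin by (meson finite_SigmaI finite_subset)
  moreover have "trans (lt W)"
    using lin by (auto simp: lt_def order_on_defs trans_def antisym_def)
  then have "acyclic (lt W)" by (auto simp: acyclic_def lt_def trancl_id)
  ultimately have wf: "wf (lt W)" by (rule finite_acyclic_wf)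
  have same: "block_of W u = block_of W v" if "(u, v) \<in> step W" for u v
  proof -
    let ?r = "(step W \<union> (step W)\<inverse>)\<^sup>*"
    have "(u, v) \<in> ?r" "(v, u) \<in> ?r" using that by auto
    then show ?thesis unfolding block_of_def by (auto intro: rtrancl_trans)
  qed
  have "v \<in> points W \<longrightarrow> block_of W v \<in> block_of W ` block_starts W" for v
    using wf
  proof (induction v rule: wf_induct_rule)
    case (less v)
    show ?case
    proof (cases "v \<in> Range (step W)")
      case True
      then obtain u where u: "(u, v) \<in> step W" by auto
      then have "(u, v) \<in> lt W" using step_subset_lt[OF assms] by auto
      then have "block_of W u \<in> block_of W ` block_starts W"
        using less lt_subset[OF assms] by blast
      then show ?thesis using same[OF u] by simp
    qed (auto simp: block_starts_def)
  qed
  then have "block_of W ` points W \<subseteq> block_of W ` block_starts W" by blast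
  moreover have "finite (block_starts W)" using fin by (simp add: block_starts_def)
  ultimately show ?thesis
    unfolding width_def by (meson card_image_le card_mono finite_imageI le_trans)
qed

text \<open>Block starts replace the width as the measure of a label: bounds on them follow from
  inclusions between sets of points.\<close>

definition has_split_tree ::
  "'a set \<Rightarrow> interval set \<Rightarrow> nat \<Rightarrow> ('v, 'a) split_tcw \<Rightarrow> bool" where
  "has_split_tree Sig Is K W \<longleftrightarrow>
     (\<exists>t. is_split_tree Sig Is t \<and> root t = W \<and>
        (\<forall>W'\<in>set_split_tree t. card (block_starts W') \<le> K))"

lemma is_split_tree_labels:
  "is_split_tree Sig Is t \<Longrightarrow> W \<in> set_split_tree t \<Longrightarrow> is_split_tcw Sig Is W"
  by (induction t) auto

lemma root_in_set_split_tree: "root t \<in> set_split_tree t"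
  by (cases t) auto

lemma split_width_le:
  assumes "has_split_tree Sig Is K W"
  shows "split_width Sig Is W \<le> enat K"
proof -
  obtain t where t: "is_split_tree Sig Is t" "root t = W"
    "\<forall>W'\<in>set_split_tree t. card (block_starts W') \<le> K"
    using assms by (auto simp: has_split_tree_def)
  have fin: "finite (set_split_tree t)" by (induction t) auto
  have "width W' \<le> K" if "W' \<in> set_split_tree t" for W'
    using width_le_block_starts[OF is_split_tree_labels[OF t(1) that]] t(3) that
    by (meson le_trans)
  then have "tree_width t \<le> K"
    unfolding tree_width_def using fin root_in_set_split_tree[of t] by (subst Max_le_iff) auto
  then show ?thesis unfolding split_width_def using t by (intro Inf_lower2[of "enat (tree_width t)"]) auto
qed

section \<open>Operations on split-trees\<close>

lemma has_split_tree_Leaf: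
  "is_split_tcw Sig Is W \<Longrightarrow> atomic W \<Longrightarrow> card (block_starts W) \<le> K \<Longrightarrow> has_split_tree Sig Is K W"
  unfolding has_split_tree_def by (rule exI[of _ "Leaf W"]) auto

lemma has_split_tree_Unary:
  assumes "is_split_tcw Sig Is W" "connected_word W" "e \<in> step W" "card (block_starts W) \<le> K"
    "has_split_tree Sig Is K (cut W e)"
  shows "has_split_tree Sig Is K W"
proof -
  obtain t where "is_split_tree Sig Is t \<and> root t = cut W e \<and>
      (\<forall>W'\<in>set_split_tree t. card (block_starts W') \<le> K)"
    using assms(5) unfolding has_split_tree_def by auto
  then show ?thesis using assms unfolding has_split_tree_def
    by (intro exI[of _ "Unary W t"]) auto
qed

lemma has_split_tree_Binary:
  assumes W: "is_split_tcw Sig Is W" and U: "link_closed W U" "U \<noteq> {}" "U \<noteq> points W"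
    and K: "card (block_starts W) \<le> K"
    and T: "has_split_tree Sig Is K (induced W U)" "has_split_tree Sig Is K (induced W (points W - U))"
  shows "has_split_tree Sig Is K W"
proof -
  obtain t1 t2 where
    "is_split_tree Sig Is t1 \<and> root t1 = induced W U \<and>
      (\<forall>W'\<in>set_split_tree t1. card (block_starts W') \<le> K)"
    "is_split_tree Sig Is t2 \<and> root t2 = induced W (points W - U) \<and>
      (\<forall>W'\<in>set_split_tree t2. card (block_starts W') \<le> K)"
    using T unfolding has_split_tree_def by auto
  moreover have "\<not> connected_word W" using connected_word_iff[OF W] U by auto
  moreover have "disjoint_union_of W (induced W U) (induced W (points W - U))"
    unfolding disjoint_union_of_def union_of_components_iff[OF W]
    using U link_closed_Diff[OF W U(1)]
    by (intro exI[of _ U] exI[of _ "points W - U"]) (auto simp: link_closed_def)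
  ultimately show ?thesis using W K unfolding has_split_tree_def
    by (intro exI[of _ "Binary W t1 t2"]) auto
qed

lemma link_closed_induced:
  "link_closed W U \<Longrightarrow> link_closed W V \<Longrightarrow> V \<subseteq> U \<Longrightarrow> link_closed (induced W U) V"
  by (auto simp: link_closed_def link_induced)

text \<open>A closed set contains the predecessor of each of its points along a present edge, so
  restricting to it creates no new block start.\<close>

lemma card_block_starts_induced:
  assumes "is_split_tcw Sig Is W" "link_closed W U"
  shows "card (block_starts (induced W U)) \<le> card (block_starts W)"
proof (rule card_mono)
  show "finite (block_starts W)" using split_tcw_finite[OF assms(1)] by (simp add: block_starts_def)
  show "block_starts (induced W U) \<subseteq> block_starts W"
    using assms(2) by (fastforce simp: block_starts_def link_closed_def link_def)
qed

lemma atomic_connected: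
  assumes "is_split_tcw Sig Is W" "atomic W"
  shows "connected_word W"
proof -
  have "U = points W" if U: "link_closed W U" "U \<noteq> {}" for U
  proof (cases "\<exists>p. points W = {p}")
    case False
    then obtain p q I where "points W = {p, q}" "tc W = (\<lambda>J. if J = I then {(p, q)} else {})"
      using assms(2) by (auto simp: atomic_def)
    then have "(p, q) \<in> link W" "points W = {p, q}" by (auto simp: link_def)
    then show ?thesis using U by (auto simp: link_closed_def)
  qed (use U in \<open>auto simp: link_closed_def\<close>)
  then show ?thesis using connected_word_iff[OF assms(1)] by auto
qed

text \<open>A split-tree can be pruned to a union of components. Labels of leaves and unary nodes
  are connected, so there \<open>U\<close> is everything; at a binary node the pruning continues in
  the children that \<open>U\<close> meets.\<close>

lemma has_split_tree_induced:
  assumes "has_split_tree Sig Is K W" "link_closed W U" "U \<noteq> {}"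
  shows "has_split_tree Sig Is K (induced W U)"
proof -
  have "has_split_tree Sig Is K (induced (root t) U)"
    if "is_split_tree Sig Is t" "\<forall>W'\<in>set_split_tree t. card (block_starts W') \<le> K"
      "link_closed (root t) U" "U \<noteq> {}" for t U
    using that
  proof (induction t arbitrary: U)
    case (Leaf W)
    then have "U = points W" using atomic_connected connected_word_iff by fastforce
    then show ?case using Leaf induced_points[of Sig Is W] by (auto intro: has_split_tree_Leaf)
  next
    case (Unary W t)
    then have "U = points W" using connected_word_iff by fastforce
    moreover have "has_split_tree Sig Is K W"
      unfolding has_split_tree_def using Unary.prems by (intro exI[of _ "Unary W t"]) auto
    ultimately show ?case using Unary induced_points[of Sig Is W] by auto
  next
    case (Binary W t1 t2)
    have W: "is_split_tcw Sig Is W" and Uc: "link_closed W U" using Binary.prems by auto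
    obtain U1 U2 where U12: "U1 \<inter> U2 = {}" "U1 \<union> U2 = points W"
      "link_closed W U1" "link_closed W U2" "root t1 = induced W U1" "root t2 = induced W U2"
      using Binary.prems by (auto simp: disjoint_union_of_def union_of_components_iff[OF W])
    have "U1 \<subseteq> points W" "U2 \<subseteq> points W" using U12 by auto
    note U12 = this U12
    have cl: "link_closed W (U \<inter> V)" if "link_closed W V" for V
      using that Uc by (auto simp: link_closed_def)
    have sub: "has_split_tree Sig Is K (induced W (U \<inter> U1))" if "U \<inter> U1 \<noteq> {}"
      using Binary.IH(1)[of "U \<inter> U1"] Binary.prems that U12
        link_closed_induced[OF _ cl, of U1 U1] induced_induced[OF W, of "U \<inter> U1" U1] by auto
    have sub2: "has_split_tree Sig Is K (induced W (U \<inter> U2))" if "U \<inter> U2 \<noteq> {}"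
      using Binary.IH(2)[of "U \<inter> U2"] Binary.prems that U12
        link_closed_induced[OF _ cl, of U2 U2] induced_induced[OF W, of "U \<inter> U2" U2] by auto
    have Up: "U \<subseteq> points W" using Uc by (auto simp: link_closed_def)
    \<comment> \<open>Both children of a binary node must be nonempty, so the node is kept only if
      \<open>U\<close> meets both sides; otherwise it is replaced by one pruned child.\<close>
    consider "U \<inter> U1 = {}" | "U \<inter> U2 = {}" | "U \<inter> U1 \<noteq> {}" "U \<inter> U2 \<noteq> {}" by blast
    then show ?case
    proof cases
      case 1
      then have "U \<inter> U2 = U" using Up U12 by auto
      then show ?thesis using sub2 Binary.prems by auto
    next
      case 2
      then have "U \<inter> U1 = U" using Up U12 by auto
      then show ?thesis using sub Binary.prems by auto
    next
      case 3
      have rest: "U - U \<inter> U1 = U \<inter> U2" using Up U12 by auto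
      have "card (block_starts (induced W U)) \<le> K"
        using card_block_starts_induced[OF W Uc] Binary.prems by auto
      moreover have "link_closed (induced W U) (U \<inter> U1)"
        using link_closed_induced[OF Uc cl[OF U12(5)]] by simp
      moreover have "U \<inter> U1 \<noteq> U" using 3 U12(3) by blast
      moreover have "has_split_tree Sig Is K (induced (induced W U) (U \<inter> U1))"
        "has_split_tree Sig Is K (induced (induced W U) (U - U \<inter> U1))"
        using sub[OF 3(1)] sub2[OF 3(2)] rest by (simp_all add: induced_induced[OF W _ Up])
      ultimately have "has_split_tree Sig Is K (induced W U)"
        using 3(1) by (intro has_split_tree_Binary[OF is_split_tcw_induced[OF W Up]]) simp_all
      then show ?thesis by simp
    qed
  qed
  then show ?thesis using assms unfolding has_split_tree_def by blast
qed

lemma link_cut: "link (cut W e) \<subseteq> link W"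
  by (auto simp: link_def)

text \<open>Connectedness is not required here: in a disconnected word the edge is cut inside its own
  component.\<close>

lemma has_split_tree_cut:
  assumes "is_split_tcw Sig Is W" "e \<in> step W" "card (block_starts W) \<le> K"
    "has_split_tree Sig Is K (cut W e)"
  shows "has_split_tree Sig Is K W"
  using assms
proof (induction "card (points W)" arbitrary: W rule: less_induct)
  case less
  note W = less.prems(1)
  show ?case
  proof (cases "connected_word W")
    case True
    then show ?thesis using less.prems has_split_tree_Unary by blast
  next
    case False
    obtain V where V: "link_closed W V" "V \<noteq> {}" "V \<noteq> points W"
      using False connected_word_iff[OF W] by auto
    obtain u v where e: "e = (u, v)" "(u, v) \<in> link W" "u \<in> points W" "v \<in> points W"
      using less.prems(2) step_subset_lt[OF W] lt_subset[OF W] by (cases e) (auto simp: link_def)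
    \<comment> \<open>The side of the proper closed set \<open>V\<close> that contains
      \<open>e\<close>. It has fewer points than \<open>W\<close>, so the induction hypothesis
      applies to the word induced on it.\<close>
    define U where "U = (if u \<in> V then V else points W - V)"
    have U: "link_closed W U" "U \<noteq> {}" "U \<noteq> points W" "u \<in> U" "U \<subseteq> points W"
      using V link_closed_Diff[OF W V(1)] e by (auto simp: U_def link_closed_def)
    then have eU: "e \<in> U \<times> U" using e by (auto simp: link_closed_def)
    have cutcl: "link_closed (cut W e) V'" if "link_closed W V'" for V'
      using that link_cut[of W e] by (auto simp: link_closed_def)
    have K: "card (block_starts (induced W U)) \<le> K"
      using card_block_starts_induced[OF W U(1)] less.prems by auto
    have "has_split_tree Sig Is K (induced W U)"
    proof (rule less.hyps)
      show "card (points (induced W U)) < card (points W)"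
        using U split_tcw_finite[OF W] by (auto intro: psubset_card_mono)
      show "has_split_tree Sig Is K (cut (induced W U) e)"
        using cut_induced[OF W less.prems(2) eU U(5)]
          has_split_tree_induced[OF less.prems(4) cutcl[OF U(1)] U(2)] by simp
    qed (use K U eU less.prems is_split_tcw_induced[OF W U(5)] in auto)
    \<comment> \<open>On the other side the cut is invisible, so the tree given for
      \<open>cut W e\<close> restricts to it directly.\<close>
    moreover have "has_split_tree Sig Is K (induced W (points W - U))"
      using has_split_tree_induced[OF less.prems(4) cutcl[OF link_closed_Diff[OF W U(1)]]] U
        induced_cut[OF W less.prems(2), of "points W - U"] eU by auto
    ultimately show ?thesis
      using has_split_tree_Binary[OF W U(1-3)] less.prems by auto
  qed
qed

text \<open>The two sides must respect the constraints but may be joined by present edges. These are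
  cut one at a time; the induced words do not change meanwhile, so the sum of their block starts
  bounds every intermediate word. When no crossing edge is left, a binary node separates the
  sides.\<close>

lemma has_split_tree_partition:
  assumes "is_split_tcw Sig Is W" "U \<union> V = points W" "U \<inter> V = {}" "U \<noteq> {}" "V \<noteq> {}"
    "\<And>I. tc W I \<subseteq> U \<times> U \<union> V \<times> V"
    "card (block_starts (induced W U)) + card (block_starts (induced W V)) \<le> K"
    "has_split_tree Sig Is K (induced W U)" "has_split_tree Sig Is K (induced W V)"
  shows "has_split_tree Sig Is K W"
  using assms
proof (induction "card (step W - (U \<times> U \<union> V \<times> V))" arbitrary: W rule: less_induct)
  case less
  note W = less.prems(1)
  have fin: "finite (points W)" by (rule split_tcw_finite[OF W])
  have "finite (step W)"
    using step_subset_lt[OF W] lt_subset[OF W] fin by (meson finite_SigmaI finite_subset)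
  then have finD: "finite (step W - (U \<times> U \<union> V \<times> V))" by simp
  \<comment> \<open>A point that is no target of a present edge of \<open>W\<close> is no target of
    one within its own side either.\<close>
  have "block_starts W \<subseteq> block_starts (induced W U) \<union> block_starts (induced W V)"
    using less.prems(2) by (auto simp: block_starts_def)
  moreover have "finite (block_starts (induced W U) \<union> block_starts (induced W V))"
    using fin less.prems(2)[symmetric] by (auto simp: block_starts_def)
  ultimately have K: "card (block_starts W) \<le> K"
    using less.prems(7) card_Un_le card_mono le_trans by meson
  show ?case
  proof (cases "step W \<subseteq> U \<times> U \<union> V \<times> V")
    case True
    have "link_closed W U"
      using True less.prems(2,3,6) unfolding link_closed_def link_def by fast
    moreover have V: "V = points W - U" and "U \<noteq> points W"
      using less.prems(2,3,5) by (blast, blast)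
    ultimately show ?thesis
      using has_split_tree_Binary[OF W _ less.prems(4) _ K less.prems(8)] less.prems(9)
      unfolding V by blast
  next
    case False
    then obtain e where e: "e \<in> step W" "e \<notin> U \<times> U \<union> V \<times> V" by auto
    have "has_split_tree Sig Is K (cut W e)"
    proof (rule less.hyps)
      have "step (cut W e) - (U \<times> U \<union> V \<times> V) \<subset> step W - (U \<times> U \<union> V \<times> V)" using e by auto
      then show "card (step (cut W e) - (U \<times> U \<union> V \<times> V)) < card (step W - (U \<times> U \<union> V \<times> V))"
        using finD by (rule psubset_card_mono[rotated])
      have "e \<notin> U \<times> U" "e \<notin> V \<times> V" using e by auto
      then have *: "induced (cut W e) U = induced W U" "induced (cut W e) V = induced W V"
        using induced_cut[OF W e(1)] by auto
      show "card (block_starts (induced (cut W e) U)) + card (block_starts (induced (cut W e) V)) \<le> K"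
        "has_split_tree Sig Is K (induced (cut W e) U)"
        "has_split_tree Sig Is K (induced (cut W e) V)"
        using less.prems unfolding * by auto
    qed (use less.prems is_split_tcw_cut[OF W e(1)] in \<open>simp_all\<close>)
    then show ?thesis using has_split_tree_cut[OF W e(1) K] by simp
  qed
qed

lemma has_split_tree_single:
  assumes "is_split_tcw Sig Is W" "points W = {p}" "1 \<le> K"
  shows "has_split_tree Sig Is K W"
proof (rule has_split_tree_Leaf)
  have "card (block_starts W) \<le> card {p}" using assms by (intro card_mono) (auto simp: block_starts_def)
  then show "card (block_starts W) \<le> K" using assms by simp
qed (use assms in \<open>auto simp: atomic_def\<close>)

text \<open>An atomic pair carries a hole and exactly one constraint. Simplicity excludes a second
  interval on \<open>(p, q)\<close>, and if the two points are joined by a present edge, it is cut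
  first.\<close>

lemma has_split_tree_pair:
  assumes W: "is_split_tcw Sig Is W" and p: "points W = {p, q}" and tc: "(p, q) \<in> tc W I"
    and s: "simple W" and K: "2 \<le> K"
  shows "has_split_tree Sig Is K W"
proof -
  have lin: "linear_order_on (points W) (le W)" by (rule split_tcw_linear[OF W])
  have pq: "(p, q) \<in> lt W" using tc tc_subset_lt[OF W, of I] by auto
  then have ne: "p \<noteq> q" and nqp: "(q, p) \<notin> lt W"
    using lin by (auto simp: lt_def order_on_defs antisym_def)
  have lt: "lt W = {(p, q)}"
    using pq nqp lt_subset[OF W] p by (auto simp: lt_def)
  then have ds: "direct_succ (points W) (lt W) = {(p, q)}" using ne p by (auto simp: direct_succ_def)
  have tceq: "tc W = (\<lambda>J. if J = I then {(p, q)} else {})"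
  proof
    fix J
    have sub: "tc W J \<subseteq> {(p, q)}" using tc_subset_lt[OF W, of J] lt by simp
    show "tc W J = (if J = I then {(p, q)} else {})"
    proof (cases "J = I")
      case True
      then show ?thesis using sub tc by (simp add: subset_singleton_iff) fast
    next
      case False
      then have "(p, q) \<notin> tc W J" using s tc unfolding simple_def by blast
      then show ?thesis using sub False by (simp add: subset_singleton_iff) fast
    qed
  qed
  have "card (block_starts W') \<le> K" if "points W' = {p, q}" for W' :: "('b, 'a) split_tcw"
  proof -
    have "card (block_starts W') \<le> card {p, q}"
      using that by (intro card_mono) (auto simp: block_starts_def)
    then show ?thesis using K card_insert_le_m1[of 2 "{q}" p] ne by simp
  qed
  note c = this
  show ?thesis
  proof (cases "step W = {}")
    case True
    then have "hole W = {(p, q)}" using split_tcw_succ[OF W] ds by simp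
    then have "atomic W"
      unfolding atomic_def using True ne p tceq
      by (intro disjI2 exI[of _ p] exI[of _ q] exI[of _ I]) simp
    then show ?thesis using has_split_tree_Leaf[OF W] c[OF p] by auto
  next
    case False
    have st: "step W = {(p, q)}" "hole W = {}"
      using False split_tcw_succ[OF W] split_tcw_disj[OF W]
      unfolding ds Un_singleton_iff by (elim disjE conjE; simp)+
    then have "atomic (cut W (p, q))"
      unfolding atomic_def using ne p tceq
      by (intro disjI2 exI[of _ p] exI[of _ q] exI[of _ I]) simp
    then have "has_split_tree Sig Is K (cut W (p, q))"
      using c[of "cut W (p, q)"] p st is_split_tcw_cut(1)[OF W]
      by (intro has_split_tree_Leaf) simp_all
    then show ?thesis using has_split_tree_cut[OF W _ c[OF p]] st by auto
  qed
qed


section \<open>Nested matchings on positions\<close>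

text \<open>The counterpart of \<open>block_starts\<close> for sets of positions. The case
  \<open>v = 0\<close> is separate because \<open>0 - 1 = 0\<close> in the natural numbers.\<close>

definition run_starts :: "nat set \<Rightarrow> nat set" where
  "run_starts A = {v \<in> A. v = 0 \<or> v - 1 \<notin> A}"

inductive decomposable :: "nat \<Rightarrow> (nat \<times> nat) set \<Rightarrow> nat set \<Rightarrow> bool" for K M where
  empty: "decomposable K M {}"
| single: "i \<notin> Field M \<Longrightarrow> decomposable K M {i}"
| pair: "(i, j) \<in> M \<Longrightarrow> decomposable K M {i, j}"
| union: "decomposable K M A \<Longrightarrow> decomposable K M B \<Longrightarrow> A \<inter> B = {} \<Longrightarrow>
    card (run_starts A) + card (run_starts B) \<le> K \<Longrightarrow> decomposable K M (A \<union> B)"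

text \<open>The shape of the constraints of one clock. The condition \<open>s' < t\<close> singles
  out pairs that belong to the same reset; between two such sources every position is again a
  source, and targets come in reverse order.\<close>

definition nested_group :: "(nat \<times> nat) set \<Rightarrow> bool" where
  "nested_group R \<longleftrightarrow> (\<forall>s t s' t' v. (s, t) \<in> R \<and> (s', t') \<in> R \<and> s < s' \<and> s' < t \<and> s \<le> v \<and> v \<le> s' \<longrightarrow>
     (\<exists>w. (v, w) \<in> R \<and> t' \<le> w \<and> w \<le> t))"

definition outgoing :: "nat \<Rightarrow> nat \<Rightarrow> (nat \<times> nat) set \<Rightarrow> (nat \<times> nat) set" where
  "outgoing a m R = {(s, t) \<in> R. a \<le> s \<and> s < m \<and> m \<le> t}"

definition incoming :: "nat \<Rightarrow> nat \<Rightarrow> (nat \<times> nat) set \<Rightarrow> (nat \<times> nat) set" where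
  "incoming a m R = {(s, t) \<in> R. s < a \<and> a \<le> t \<and> t < m}"

section \<open>Positions whose constraint ends in a given interval\<close>

locale position_matching =
  fixes M :: "(nat \<times> nat) set"
  assumes M_less: "(s, t) \<in> M \<Longrightarrow> s < t"
    and M_simple: "(s, t) \<in> M \<Longrightarrow> (s', t') \<in> M \<Longrightarrow> {s, t} \<inter> {s', t'} \<noteq> {} \<Longrightarrow> s = s' \<and> t = t'"
begin

definition last_pos :: "nat \<Rightarrow> nat" where
  "last_pos v = (if v \<in> Domain M then THE t. (v, t) \<in> M else v)"

lemma last_pos_eq: "(v, t) \<in> M \<Longrightarrow> last_pos v = t"
  unfolding last_pos_def using M_simple by (auto intro!: the_equality)

lemma last_pos_cases: "(v, last_pos v) \<in> M \<or> v \<notin> Domain M \<and> last_pos v = v"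
proof (cases "v \<in> Domain M")
  case True
  then show ?thesis using last_pos_eq by auto
qed (simp add: last_pos_def)

lemma le_last_pos: "v \<le> last_pos v"
  using last_pos_cases[of v] M_less by (auto dest: less_imp_le)

text \<open>The set \<open>U a m\<close>. The two ends of a pair in \<open>M\<close> have the same
  last position, hence lie on the same side. Sources before \<open>a\<close> may belong to it, but
  no position from \<open>m\<close> on.\<close>

definition ending_in :: "nat \<Rightarrow> nat \<Rightarrow> nat set" where
  "ending_in a m = {v. a \<le> last_pos v \<and> last_pos v < m}"

lemma finite_ending_in: "finite (ending_in a m)"
proof (rule finite_subset)
  show "ending_in a m \<subseteq> {..<m}" using le_last_pos by (auto simp: ending_in_def intro: le_less_trans)
qed simp

lemma ending_in_append: "a \<le> c \<Longrightarrow> c \<le> m \<Longrightarrow> ending_in a m = ending_in a c \<union> ending_in c m"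
  and ending_in_disjoint: "ending_in a c \<inter> ending_in c m = {}"
  by (auto simp: ending_in_def)

lemma ending_at:
  "m \<in> Domain M \<Longrightarrow> ending_in m (Suc m) = {}"
  "(s, m) \<in> M \<Longrightarrow> ending_in m (Suc m) = {s, m}"
  "m \<notin> Field M \<Longrightarrow> ending_in m (Suc m) = {m}"
proof -
  have 0: "v \<in> ending_in m (Suc m) \<longleftrightarrow> last_pos v = m" for v by (auto simp: ending_in_def)
  have 1: "last_pos v = m \<longleftrightarrow> (v, m) \<in> M \<or> v = m \<and> m \<notin> Domain M" for v
    using last_pos_cases[of v] last_pos_eq[of v m] by auto
  show "m \<in> Domain M \<Longrightarrow> ending_in m (Suc m) = {}"
  proof -
    assume m: "m \<in> Domain M"
    then obtain t where "(m, t) \<in> M" by auto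
    then have "(v, m) \<notin> M" for v using M_simple[of v m m t] M_less[of m t] by auto
    then show ?thesis using m by (auto simp: 0 1)
  qed
  show "(s, m) \<in> M \<Longrightarrow> ending_in m (Suc m) = {s, m}"
  proof -
    assume s: "(s, m) \<in> M"
    then have "(m, t) \<notin> M" for t using M_simple[of s m m t] M_less[of s m] by auto
    moreover have "v = s" if "(v, m) \<in> M" for v using M_simple[OF that s] by blast
    ultimately have "last_pos v = m \<longleftrightarrow> v \<in> {s, m}" for v using s 1 by blast
    then show ?thesis using 0 by blast
  qed
  show "m \<notin> Field M \<Longrightarrow> ending_in m (Suc m) = {m}"
    by (auto simp: 0 1 Field_def)
qed

lemma ending_in_all:
  assumes "\<And>s t. (s, t) \<in> M \<Longrightarrow> t < N"
  shows "ending_in 0 N = {..<N}"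
proof -
  have "last_pos v < N \<longleftrightarrow> v < N" for v
    using last_pos_cases[of v] le_last_pos[of v] assms by force
  then show ?thesis by (auto simp: ending_in_def)
qed

text \<open>Peeling: the added positions are those with last position \<open>m\<close>, at most a
  matched pair, so they form at most two runs. This is the \<open>2\<close> in the bound.\<close>

lemma decomposable_Suc:
  assumes "decomposable K M (ending_in a m)" "a \<le> m" "card (run_starts (ending_in a m)) + 2 \<le> K"
  shows "decomposable K M (ending_in a (Suc m))"
proof -
  have "decomposable K M (ending_in m (Suc m)) \<and> card (ending_in m (Suc m)) \<le> 2"
  proof -
    consider "m \<in> Domain M" | s where "(s, m) \<in> M" | "m \<notin> Field M" by (auto simp: Field_def)
    then show ?thesis
    proof cases
      case 2
      then show ?thesis by (simp add: ending_at decomposable.pair card_insert_if)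
    qed (simp_all add: ending_at decomposable.empty decomposable.single)
  qed
  moreover have "card (run_starts (ending_in m (Suc m))) \<le> card (ending_in m (Suc m))"
    by (intro card_mono finite_ending_in) (auto simp: run_starts_def)
  ultimately have "decomposable K M (ending_in a m \<union> ending_in m (Suc m))"
    using assms ending_in_disjoint by (intro decomposable.union) auto
  then show ?thesis using ending_in_append[of a m "Suc m"] assms(2) by simp
qed

text \<open>A run start after \<open>a\<close> is preceded by a position of the interval whose
  constraint goes out; a run start before \<open>a\<close> belongs to the set because its constraint
  comes in. Each is charged to the origin of that constraint, and no origin is charged twice at the
  same end. The summand 1 pays for \<open>a\<close> itself.\<close>

lemma card_run_starts_le:
  assumes M: "M = (\<Union>z\<in>Z. R z)" and Z: "finite Z"
    and ok: "\<And>z. z \<in> Z \<Longrightarrow> nested_group (R z) \<or>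
      (\<forall>e\<in>outgoing a m (R z). \<forall>e'\<in>outgoing a m (R z). e = e') \<and> incoming a m (R z) = {}"
  shows "card (run_starts (ending_in a m)) \<le>
    1 + card {z \<in> Z. outgoing a m (R z) \<noteq> {}} + card {z \<in> Z. incoming a m (R z) \<noteq> {}}"
proof -
  let ?U = "ending_in a m"
  define Out where "Out = {v \<in> run_starts ?U. a < v}"
  define In where "In = {v \<in> run_starts ?U. v < a}"
  have RM: "(s, t) \<in> M" if "(s, t) \<in> R z" "z \<in> Z" for s t z using that M by blast
  have ltm: "v < m" if "v \<in> ?U" for v
    using that le_last_pos[of v] by (auto simp: ending_in_def)
  have "card Out \<le> card {z \<in> Z. outgoing a m (R z) \<noteq> {}}"
  proof (rule card_le_if_inj_on_rel[where r = "\<lambda>v z. \<exists>t. (v - 1, t) \<in> outgoing a m (R z)"])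
    fix v assume "v \<in> Out"
    then have v: "a < v" "v \<in> ?U" "v - 1 \<notin> ?U" by (auto simp: Out_def run_starts_def)
    have "a \<le> v - 1" "v - 1 < m" using v ltm[OF v(2)] by auto
    then have "m \<le> last_pos (v - 1)" "(v - 1, last_pos (v - 1)) \<in> M"
      using v(3) le_last_pos[of "v - 1"] last_pos_cases[of "v - 1"] by (auto simp: ending_in_def)
    then obtain z where "z \<in> Z" "(v - 1, last_pos (v - 1)) \<in> outgoing a m (R z)"
      using M \<open>a \<le> v - 1\<close> \<open>v - 1 < m\<close> by (auto simp: outgoing_def)
    then show "\<exists>z. z \<in> {z \<in> Z. outgoing a m (R z) \<noteq> {}} \<and>
        (\<exists>t. (v - 1, t) \<in> outgoing a m (R z))" by blast
  next
    fix v v' z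
    assume vv: "v \<in> Out" "v' \<in> Out" and z: "z \<in> {z \<in> Z. outgoing a m (R z) \<noteq> {}}"
      and "\<exists>t. (v - 1, t) \<in> outgoing a m (R z)" "\<exists>t. (v' - 1, t) \<in> outgoing a m (R z)"
    then obtain t t' where t: "(v - 1, t) \<in> outgoing a m (R z)" "(v' - 1, t') \<in> outgoing a m (R z)"
      by blast
    have pos: "0 < v" "0 < v'" using vv by (auto simp: Out_def)
    \<comment> \<open>The position \<open>u\<close> lies between the sources \<open>u - 1\<close>
      and \<open>u' - 1\<close>, so it is itself a source, with a target no earlier than
      \<open>s'\<close> and thus not before \<open>m\<close>. Then \<open>u\<close> is not in the
      set.\<close>
    have False if n: "nested_group (R z)" and "u < u'" "u \<in> Out" "u' \<in> Out"
      "(u - 1, s) \<in> outgoing a m (R z)" "(u' - 1, s') \<in> outgoing a m (R z)" for u u' s s'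
    proof -
      have "(u - 1, s) \<in> R z" "(u' - 1, s') \<in> R z" "u - 1 < u' - 1" "u' - 1 < s" "m \<le> s'"
        "u - 1 \<le> u" "u \<le> u' - 1"
        using that by (auto simp: outgoing_def Out_def)
      then obtain w where "(u, w) \<in> R z" "s' \<le> w" using n unfolding nested_group_def by blast
      then have "m \<le> last_pos u" using last_pos_eq[of u w] RM z \<open>m \<le> s'\<close> by auto
      then show False using \<open>u \<in> Out\<close> by (auto simp: Out_def run_starts_def ending_in_def)
    qed
    then have "v = v'" if "nested_group (R z)" using vv t that by (meson linorder_neqE_nat)
    moreover have "v = v'" if "\<not> nested_group (R z)"
    proof -
      have "(v - 1, t) = (v' - 1, t')" using ok[of z] z t that by blast
      then show ?thesis using pos by auto
    qed
    ultimately show "v = v'" by blast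
  qed (use Z in simp)
  moreover have "card In \<le> card {z \<in> Z. incoming a m (R z) \<noteq> {}}"
  proof (rule card_le_if_inj_on_rel[where r = "\<lambda>v z. (v, last_pos v) \<in> incoming a m (R z)"])
    fix v assume "v \<in> In"
    then have v: "v < a" "a \<le> last_pos v" "last_pos v < m"
      by (auto simp: In_def run_starts_def ending_in_def)
    then have "(v, last_pos v) \<in> M" using last_pos_cases[of v] by auto
    then obtain z where "z \<in> Z" "(v, last_pos v) \<in> incoming a m (R z)"
      using M v by (auto simp: incoming_def)
    then show "\<exists>z. z \<in> {z \<in> Z. incoming a m (R z) \<noteq> {}} \<and> (v, last_pos v) \<in> incoming a m (R z)"
      by blast
  next
    fix v v' z
    assume *: "v \<in> In" "v' \<in> In" "z \<in> {z \<in> Z. incoming a m (R z) \<noteq> {}}"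
      "(v, last_pos v) \<in> incoming a m (R z)" "(v', last_pos v') \<in> incoming a m (R z)"
    \<comment> \<open>The other alternative of \<open>ok\<close> allows no incoming pair.\<close>
    then have n: "nested_group (R z)" using ok[of z] by blast
    \<comment> \<open>The target of \<open>u' - 1\<close> lies between those of \<open>u'\<close>
      and \<open>u\<close>, hence in the interval; so \<open>u' - 1\<close> is in the set and
      \<open>u'\<close> starts no run.\<close>
    have False if "u < u'" "u' \<in> In" "(u, last_pos u) \<in> incoming a m (R z)"
      "(u', last_pos u') \<in> incoming a m (R z)" for u u'
    proof -
      have "(u, last_pos u) \<in> R z" "(u', last_pos u') \<in> R z" "u < u'" "u' < last_pos u" "u \<le> u' - 1" "u' - 1 \<le> u'"
        using that by (auto simp: incoming_def)
      then obtain w where w: "(u' - 1, w) \<in> R z" "last_pos u' \<le> w" "w \<le> last_pos u"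
        using n unfolding nested_group_def by blast
      then have "last_pos (u' - 1) = w" using last_pos_eq RM *(3) by blast
      then have "u' - 1 \<in> ?U" using w that by (auto simp: incoming_def ending_in_def)
      then show False using that by (auto simp: In_def run_starts_def)
    qed
    then show "v = v'" using * by (meson linorder_neqE_nat)
  qed (use Z in simp)
  moreover have "card (run_starts ?U) \<le> card ({a} \<union> Out \<union> In)"
    using finite_ending_in[of a m] by (intro card_mono) (auto simp: Out_def In_def run_starts_def)
  moreover have "card ({a} \<union> Out \<union> In) \<le> 1 + card Out + card In"
    using card_Un_le[of "{a} \<union> Out" In] card_Un_le[of "{a}" Out] by simp
  ultimately show ?thesis by linarith
qed

end

section \<open>Decomposition in the presence of clocks and a stack\<close>

locale clock_positions = position_matching M
  for M :: "(nat \<times> nat) set" +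
  fixes X :: "'x set" and R :: "'x origin \<Rightarrow> (nat \<times> nat) set"
  assumes X: "finite X" and M_eq: "M = (\<Union>z\<in>{Stack, Zeta} \<union> Clock ` X. R z)"
    and Zeta: "nested_group (R Zeta)"
    and Clock: "x \<in> X \<Longrightarrow> nested_group (R (Clock x))"
    and Stack: "(s, t) \<in> R Stack \<Longrightarrow> (s', t') \<in> R Stack \<Longrightarrow> s < s' \<Longrightarrow> s' < t \<Longrightarrow> t' < t"
    and push_base: "(p, q) \<in> R Stack \<Longrightarrow> \<exists>c\<le>p. (\<forall>(s, t)\<in>R Zeta. \<not> (s < c \<and> c \<le> t)) \<and>
      (\<forall>v\<in>Field (R Stack). \<not> (c \<le> v \<and> v < p))"
begin

lemma card_insert_Clock_le: "card (insert Zeta (Clock ` X)) \<le> card X + 1"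
  using X card_image_le[OF X, of Clock] by (simp add: card_insert_if)

text \<open>Nothing comes into an interval beginning at 0, and only clocks and \<open>Zeta\<close>
  can go out: at most \<open>1 + (card X + 1)\<close> runs, plus the two of a peeled pair.\<close>

lemma decomposable_timed_automaton:
  assumes "R Stack = {}"
  shows "decomposable (card X + 4) M (ending_in 0 m)"
proof (induction m)
  case 0
  then show ?case by (simp add: ending_in_def decomposable.empty)
next
  case (Suc m)
  let ?Z = "insert Zeta (Clock ` X)"
  have "card (run_starts (ending_in 0 m)) \<le>
    1 + card {z \<in> ?Z. outgoing 0 m (R z) \<noteq> {}} + card {z \<in> ?Z. incoming 0 m (R z) \<noteq> {}}"
    using M_eq assms X Zeta Clock by (intro card_run_starts_le) auto
  moreover have "card {z \<in> ?Z. outgoing 0 m (R z) \<noteq> {}} \<le> card X + 1"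
    using X by (intro order_trans[OF card_mono card_insert_Clock_le]) auto
  moreover have "card {z \<in> ?Z. incoming 0 m (R z) \<noteq> {}} = 0"
    by (simp add: incoming_def)
  ultimately have "card (run_starts (ending_in 0 m)) + 2 \<le> card X + 4"
    by linarith
  then show ?case using Suc decomposable_Suc by blast
qed

text \<open>The intervals met in the recursive decomposition.  They cross no \<open>Zeta\<close> constraint on the
  left, and at most one stack constraint, whose push lies inside and whose pop comes later.\<close>

definition good_interval :: "nat \<Rightarrow> nat \<Rightarrow> bool" where
  "good_interval a m \<longleftrightarrow> a \<le> m \<and> (\<forall>(s, t)\<in>R Zeta. \<not> (s < a \<and> a \<le> t)) \<and>
     incoming a m (R Stack) = {} \<and>
     (\<forall>e\<in>outgoing a m (R Stack). \<forall>e'\<in>outgoing a m (R Stack). e = e')"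

text \<open>All origins may go out, but only clocks may come in:
  \<open>1 + (card X + 2) + card X\<close>.\<close>

lemma card_run_starts_good:
  assumes "good_interval a m"
  shows "card (run_starts (ending_in a m)) \<le> 2 * card X + 3"
proof -
  let ?Z = "{Stack, Zeta} \<union> Clock ` X"
  have "card (run_starts (ending_in a m)) \<le>
    1 + card {z \<in> ?Z. outgoing a m (R z) \<noteq> {}} + card {z \<in> ?Z. incoming a m (R z) \<noteq> {}}"
    using M_eq X Zeta Clock assms by (intro card_run_starts_le) (auto simp: good_interval_def)
  moreover have "card {z \<in> ?Z. outgoing a m (R z) \<noteq> {}} \<le> card (insert Stack (insert Zeta (Clock ` X)))"
    using X by (intro card_mono) auto
  then have "card {z \<in> ?Z. outgoing a m (R z) \<noteq> {}} \<le> card X + 2"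
    using X card_insert_Clock_le by (simp add: card_insert_if split: if_splits)
  moreover have "card {z \<in> ?Z. incoming a m (R z) \<noteq> {}} \<le> card X"
  proof -
    have "{z \<in> ?Z. incoming a m (R z) \<noteq> {}} \<subseteq> Clock ` X"
      using assms by (auto simp: good_interval_def incoming_def)
    then show ?thesis using X by (meson card_image_le card_mono finite_imageI order_trans)
  qed
  ultimately show ?thesis by linarith
qed

lemma Stack_subset_M: "R Stack \<subseteq> M"
  using M_eq by auto

text \<open>Peeling a pop makes its stack constraint outgoing, which is harmful exactly when another
  one goes out already. In that case the interval is cut before the matching push, and the two good
  halves cost \<open>2 * (2 * card X + 3)\<close>.\<close>

lemma decomposable_good:
  assumes "good_interval a m"
  shows "decomposable (4 * card X + 6) M (ending_in a m)"
  using assms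
proof (induction "m - a" arbitrary: a m rule: less_induct)
  case less
  note good = less.prems
  note St = subsetD[OF Stack_subset_M]
  show ?case
  proof (cases "a = m")
    case True
    then have "ending_in a m = {}" by (auto simp: ending_in_def)
    then show ?thesis by (simp add: decomposable.empty)
  next
    case False
    then obtain q where q: "m = Suc q" "a \<le> q"
      using good by (cases m) (auto simp: good_interval_def)
    show ?thesis
    proof (cases "\<exists>p s t. (p, q) \<in> R Stack \<and> (s, t) \<in> outgoing a m (R Stack)")
      case False
      \<comment> \<open>Peeling case. Only a stack pair ending at \<open>q\<close> can become
        outgoing, and then no other one goes out.\<close>
      have "good_interval a q"
        unfolding good_interval_def
      proof (intro conjI ballI)
        fix e e' assume e: "e \<in> outgoing a q (R Stack)" "e' \<in> outgoing a q (R Stack)"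
        obtain s t s' t' where st: "e = (s, t)" "e' = (s', t')" by fastforce
        show "e = e'"
        proof (cases "\<exists>p. (p, q) \<in> R Stack")
          case True
          then have "(s, t) \<notin> outgoing a m (R Stack)" "(s', t') \<notin> outgoing a m (R Stack)"
            using False by blast+
          then have "t < m" "t' < m" using e st q by (auto simp: outgoing_def)
          then have "t = q" "t' = q" using e st q by (auto simp: outgoing_def)
          then show ?thesis using e st M_simple[of s q s' q] St by (auto simp: outgoing_def)
        next
          case False
          then have "t \<noteq> q" "t' \<noteq> q" using e st by (auto simp: outgoing_def)
          then have "e \<in> outgoing a m (R Stack)" "e' \<in> outgoing a m (R Stack)"
            using e st q by (auto simp: outgoing_def)
          then show ?thesis using good by (auto simp: good_interval_def)
        qed
      next
        have "incoming a q (R Stack) \<subseteq> incoming a m (R Stack)"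
          using q by (auto simp: incoming_def)
        then show "incoming a q (R Stack) = {}" using good by (simp add: good_interval_def)
      qed (use good q in \<open>simp_all add: good_interval_def\<close>)
      then show ?thesis
        using less.hyps[of q a] card_run_starts_good[of a q] decomposable_Suc[of _ a q] q by simp
    next
      case True
      then obtain p s0 t0 where pq: "(p, q) \<in> R Stack" and o: "(s0, t0) \<in> outgoing a m (R Stack)"
        by blast
      have o': "(s0, t0) \<in> R Stack" "a \<le> s0" "s0 < m" "m \<le> t0" using o by (auto simp: outgoing_def)
      \<comment> \<open>A push before \<open>a\<close> would make \<open>(p, q)\<close> incoming; so
        the push lies in the interval.\<close>
      have "(p, q) \<notin> incoming a m (R Stack)" using good by (simp add: good_interval_def)
      then have p: "a \<le> p" "p < q" using pq q M_less[OF St[OF pq]] by (auto simp: incoming_def)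
      \<comment> \<open>The cut goes to \<open>c\<close> and not to \<open>p\<close>, as a cut at
        \<open>p\<close> might separate the ends of a \<open>Zeta\<close> constraint.\<close>
      obtain c where c: "c \<le> p" "\<forall>(s, t)\<in>R Zeta. \<not> (s < c \<and> c \<le> t)"
        "\<forall>v\<in>Field (R Stack). \<not> (c \<le> v \<and> v < p)"
        using push_base[OF pq] by blast
      have sp: "s = p \<longleftrightarrow> t = q" "s \<noteq> q" "t \<noteq> p" if "(s, t) \<in> R Stack" for s t
        using M_simple[OF St[OF that] St[OF pq]] p by auto
      have nc: "s < c \<or> p \<le> s" "t < c \<or> p \<le> t" if "(s, t) \<in> R Stack" for s t
        using c(3) that by (auto simp: Field_def not_le)
      have nest: "t < q" if "(s, t) \<in> R Stack" "p < s" "s < q" for s t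
        using Stack[OF pq that(1)] that by auto
      have nest': "t < p \<or> q < t" if "(s, t) \<in> R Stack" "s < p" for s t
        using Stack[OF that(1) pq] that sp[OF that(1)] by force
      \<comment> \<open>The outgoing constraint ends after \<open>q\<close>, so by nesting it cannot
        start between \<open>p\<close> and \<open>q\<close>; and no stack point lies in
        \<open>[c, p)\<close>. Hence \<open>a < c\<close>, which makes the right half strictly
        shorter.\<close>
      have "s0 < c" using nest[OF o'(1)] nc[OF o'(1)] sp[OF o'(1)] o' q by force
      \<comment> \<open>A stack pair that crosses \<open>c\<close> encloses \<open>(p, q)\<close>.
        So what leaves \<open>[a, c)\<close> leaves \<open>[a, m)\<close> as well, and nothing comes
        into \<open>[c, m)\<close>.\<close>
      have left: "m \<le> t" if "(s, t) \<in> R Stack" "s < c" "c \<le> t" for s t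
        using nest'[OF that(1)] nc(2)[OF that(1)] that c(1) q by auto
      have "outgoing a c (R Stack) \<subseteq> outgoing a m (R Stack)"
        using left c(1) p q by (auto simp: outgoing_def)
      moreover have "incoming a c (R Stack) \<subseteq> incoming a m (R Stack)"
        using c(1) p q by (auto simp: incoming_def)
      moreover have "a \<le> c" using \<open>s0 < c\<close> o' by simp
      ultimately have g1: "good_interval a c" using good unfolding good_interval_def by blast
      have "incoming c m (R Stack) = {}"
        using left by (fastforce simp: incoming_def)
      moreover have "outgoing c m (R Stack) = {}"
      proof -
        \<comment> \<open>A stack pair starting from \<open>c\<close> on and before \<open>m\<close>
          is \<open>(p, q)\<close> or is nested inside it.\<close>
        have "t < m" if "(s, t) \<in> R Stack" "c \<le> s" "s < m" for s t
          using nc(1)[OF that(1)] sp[OF that(1)] nest[OF that(1)] that q by force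
        then show ?thesis by (fastforce simp: outgoing_def)
      qed
      ultimately have g2: "good_interval c m" using c p q by (auto simp: good_interval_def)
      have "decomposable (4 * card X + 6) M (ending_in a c \<union> ending_in c m)"
      proof (rule decomposable.union)
        show "decomposable (4 * card X + 6) M (ending_in a c)"
          using g1 p c(1) q by (intro less.hyps) auto
        show "decomposable (4 * card X + 6) M (ending_in c m)"
          using g2 \<open>s0 < c\<close> o' by (intro less.hyps) auto
        show "card (run_starts (ending_in a c)) + card (run_starts (ending_in c m)) \<le> 4 * card X + 6"
          using card_run_starts_good[OF g1] card_run_starts_good[OF g2] by linarith
      qed (rule ending_in_disjoint)
      then show ?thesis
        using ending_in_append[of a c m] g1 g2 by (simp add: good_interval_def)
    qed
  qed
qed

lemma good_interval_all:
  assumes "\<And>s t. (s, t) \<in> M \<Longrightarrow> t < N"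
  shows "good_interval 0 N"
  using assms Stack_subset_M by (fastforce simp: good_interval_def incoming_def outgoing_def)

end


section \<open>Positions in generated words\<close>

definition position :: "('v, 'a) split_tcw \<Rightarrow> 'v \<Rightarrow> nat" where
  "position W v = card {u. (u, v) \<in> lt W}"

context
  fixes Sig :: "'a set" and Is :: "interval set" and W :: "('v, 'a) split_tcw"
  assumes W: "is_split_tcw Sig Is W"
begin

lemma trans_lt: "trans (lt W)"
  using split_tcw_linear[OF W] by (auto simp: lt_def order_on_defs trans_def antisym_def)

lemma position_less_iff:
  assumes "u \<in> points W" "v \<in> points W"
  shows "position W u < position W v \<longleftrightarrow> (u, v) \<in> lt W"
proof -
  have less: "position W x < position W y" if "(x, y) \<in> lt W" for x y
    unfolding position_def
  proof (rule psubset_card_mono)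
    show "finite {u. (u, y) \<in> lt W}"
      using lt_subset[OF W] split_tcw_finite[OF W] by (rule_tac finite_subset) auto
    have "(x, x) \<notin> lt W" by (simp add: lt_def)
    then show "{u. (u, x) \<in> lt W} \<subset> {u. (u, y) \<in> lt W}"
      using that trans_lt by (auto dest: transD)
  qed
  have "u = v \<or> (u, v) \<in> lt W \<or> (v, u) \<in> lt W"
    using split_tcw_linear[OF W] assms by (auto simp: lt_def order_on_defs total_on_def)
  then show ?thesis using less[of u v] less[of v u] by fastforce
qed

lemma inj_on_position: "inj_on (position W) (points W)"
proof (rule inj_onI)
  fix u v assume uv: "u \<in> points W" "v \<in> points W" "position W u = position W v"
  have "u = v \<or> (u, v) \<in> lt W \<or> (v, u) \<in> lt W"
    using split_tcw_linear[OF W] uv by (auto simp: lt_def order_on_defs total_on_def)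
  then show "u = v" using position_less_iff[of u v] position_less_iff[of v u] uv by simp
qed

lemma position_image: "position W ` points W = {..<card (points W)}"
proof (rule card_subset_eq)
  have "position W v < card (points W)" if "v \<in> points W" for v
    unfolding position_def
  proof (rule psubset_card_mono[OF split_tcw_finite[OF W]])
    have "v \<notin> {u. (u, v) \<in> lt W}" by (simp add: lt_def)
    then show "{u. (u, v) \<in> lt W} \<subset> points W" using lt_subset[OF W] that by blast
  qed
  then show "position W ` points W \<subseteq> {..<card (points W)}" by auto
  show "card (position W ` points W) = card {..<card (points W)}"
    using card_image[OF inj_on_position] by simp
qed simp

lemma step_iff_position:
  assumes "hole W = {}"
  shows "(u, v) \<in> step W \<longleftrightarrow> u \<in> points W \<and> v \<in> points W \<and> position W v = Suc (position W u)"
proof -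
  have "(u, v) \<in> step W \<longleftrightarrow> (u, v) \<in> direct_succ (points W) (lt W)"
    using split_tcw_succ[OF W] assms by simp
  also have "\<dots> \<longleftrightarrow> u \<in> points W \<and> v \<in> points W \<and> position W u < position W v \<and>
      \<not> (\<exists>w\<in>points W. position W u < position W w \<and> position W w < position W v)"
    by (auto simp: direct_succ_def position_less_iff)
  also have "\<dots> \<longleftrightarrow> u \<in> points W \<and> v \<in> points W \<and> position W v = Suc (position W u)"
  proof (intro conj_cong refl iffI)
    assume v: "v \<in> points W" and *: "position W u < position W v \<and>
      \<not> (\<exists>w\<in>points W. position W u < position W w \<and> position W w < position W v)"
    show "position W v = Suc (position W u)"
    proof (rule ccontr)
      assume "position W v \<noteq> Suc (position W u)"
      then have "Suc (position W u) < position W v" using * by simp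
      \<comment> \<open>Positions form an initial segment of the naturals, so the number just after
        \<open>position W u\<close> is taken by a point strictly between.\<close>
      moreover have "position W v \<in> {..<card (points W)}" using v position_image by blast
      ultimately have "Suc (position W u) \<in> position W ` points W" using position_image by simp
      then show False using * \<open>Suc (position W u) < position W v\<close> by force
    qed
  qed auto
  finally show ?thesis .
qed

end

section \<open>From decompositions of positions to split-trees\<close>

definition points_at :: "('v, 'a) split_tcw \<Rightarrow> nat set \<Rightarrow> 'v set" where
  "points_at W A = {v \<in> points W. position W v \<in> A}"

text \<open>Intervals are forgotten, since the decomposition depends only on which positions are
  matched.\<close>

definition matched_positions :: "('v, 'a) split_tcw \<Rightarrow> (nat \<times> nat) set" where
  "matched_positions W = map_prod (position W) (position W) ` (\<Union>I. tc W I)"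

context
  fixes Sig :: "'a set" and Is :: "interval set" and W :: "('v, 'a) split_tcw"
  assumes stcw: "is_stcw Sig Is W"
begin

lemma stcw_split: "is_split_tcw Sig Is W"
  and stcw_hole: "hole W = {}"
  and stcw_simple: "simple W"
  using stcw by (auto simp: is_stcw_def is_tcw_def)

lemma tc_points: "(u, v) \<in> tc W I \<Longrightarrow> u \<in> points W \<and> v \<in> points W \<and> (u, v) \<in> lt W"
  using tc_subset_lt[OF stcw_split, of I] lt_subset[OF stcw_split] by blast

lemma position_matching: "position_matching (matched_positions W)"
proof
  fix s t assume st: "(s, t) \<in> matched_positions W"
  then show "s < t"
    using tc_points position_less_iff[OF stcw_split] by (auto simp: matched_positions_def)
  fix s' t' assume st': "(s', t') \<in> matched_positions W" and ne: "{s, t} \<inter> {s', t'} \<noteq> {}"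
  obtain u v I where uv: "(u, v) \<in> tc W I" "s = position W u" "t = position W v"
    using st by (auto simp: matched_positions_def)
  obtain u' v' J where uv': "(u', v') \<in> tc W J" "s' = position W u'" "t' = position W v'"
    using st' by (auto simp: matched_positions_def)
  have "{u, v} \<inter> {u', v'} \<noteq> {}"
    using ne uv uv' tc_points[OF uv(1)] tc_points[OF uv'(1)]
      inj_on_eq_iff[OF inj_on_position[OF stcw_split]] by auto
  then have "u = u' \<and> v = v'" using stcw_simple uv uv' unfolding simple_def by blast
  then show "s = s' \<and> t = t'" using uv uv' by simp
qed

lemma decomposable_closed:
  assumes "decomposable K (matched_positions W) A" "(s, t) \<in> matched_positions W"
  shows "s \<in> A \<longleftrightarrow> t \<in> A"
  using assms(1)
proof induction
  case (single i)
  then show ?case using assms(2) by (auto simp: Field_def)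
next
  case (pair i j)
  then show ?case using position_matching.M_simple[OF position_matching assms(2), of i j] by auto
qed auto

text \<open>Without holes in \<open>W\<close>, all consecutive positions are joined by present
  edges; so a point whose predecessor position is in \<open>A\<close> starts no block.\<close>

lemma card_block_starts_le:
  assumes "A \<subseteq> {..<card (points W)}"
  shows "card (block_starts (induced W (points_at W A))) \<le> card (run_starts A)"
proof (rule card_inj_on_le)
  show "inj_on (position W) (block_starts (induced W (points_at W A)))"
    by (rule inj_on_subset[OF inj_on_position[OF stcw_split]]) (auto simp: block_starts_def points_at_def)
  show "finite (run_starts A)"
    by (rule finite_subset[OF _ finite_lessThan[of "card (points W)"]])
      (use assms in \<open>auto simp: run_starts_def\<close>)
  show "position W ` block_starts (induced W (points_at W A)) \<subseteq> run_starts A"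
  proof (intro image_subsetI)
    fix v assume v: "v \<in> block_starts (induced W (points_at W A))"
    then have vA: "v \<in> points W" "position W v \<in> A" by (auto simp: block_starts_def points_at_def)
    have False if k: "position W v \<noteq> 0" "position W v - 1 \<in> A"
    proof -
      have "position W v - 1 \<in> position W ` points W"
        using k(2) assms position_image[OF stcw_split] by auto
      then obtain u where u: "u \<in> points W" "position W u = position W v - 1" by auto
      then have "(u, v) \<in> step W" "u \<in> points_at W A"
        using k vA step_iff_position[OF stcw_split stcw_hole] by (auto simp: points_at_def)
      then show False using v by (auto simp: block_starts_def)
    qed
    then show "position W v \<in> run_starts A" using vA by (auto simp: run_starts_def)
  qed
qed

lemma points_at_position:
  assumes "v \<in> points W"
  shows "points_at W {position W v} = {v}"
  using assms inj_on_eq_iff[OF inj_on_position[OF stcw_split]] by (auto simp: points_at_def)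

text \<open>Each rule becomes a construction of trees, the union rule being
  \<open>has_split_tree_partition\<close>. Split-trees have no empty labels, so a union with an
  empty part is skipped.\<close>

lemma has_split_tree_decomposable:
  assumes "decomposable K (matched_positions W) A" "A \<subseteq> {..<card (points W)}" "A \<noteq> {}" "2 \<le> K"
  shows "has_split_tree Sig Is K (induced W (points_at W A))"
  using assms(1-3)
proof induction
  case (single i)
  then obtain v where v: "v \<in> points W" "i = position W v"
    using position_image[OF stcw_split] by blast
  show ?case unfolding v(2) points_at_position[OF v(1)]
    using v assms(4) is_split_tcw_induced[OF stcw_split, of "{v}"]
    by (intro has_split_tree_single) auto
next
  case (pair i j)
  then obtain u v I where uv: "(u, v) \<in> tc W I" "i = position W u" "j = position W v"
    by (auto simp: matched_positions_def)
  have uvp: "u \<in> points W" "v \<in> points W" using tc_points[OF uv(1)] by auto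
  have "points_at W {i, j} = points_at W {i} \<union> points_at W {j}" by (auto simp: points_at_def)
  then have eq: "points_at W {i, j} = {u, v}" using points_at_position uvp uv by auto
  have "simple (induced W {u, v})" using stcw_simple unfolding simple_def induced_sel by blast
  then show ?case unfolding eq
    using uv uvp assms(4) is_split_tcw_induced[OF stcw_split, of "{u, v}"]
    by (intro has_split_tree_pair[of Sig Is _ u v I]) auto
next
  case (union A B)
  show ?case
  proof (cases "A = {} \<or> B = {}")
    case True
    then consider "A = {}" | "B = {}" by blast
    then show ?thesis using union.IH union.prems by cases simp_all
  next
    case False
    let ?V = "points_at W (A \<union> B)"
    have sub: "A \<subseteq> {..<card (points W)}" "B \<subseteq> {..<card (points W)}" using union by auto
    have ne: "points_at W D \<noteq> {}" if D: "D \<subseteq> {..<card (points W)}" "D \<noteq> {}" for D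
    proof -
      obtain k where "k \<in> D" using D by auto
      moreover then obtain v where "v \<in> points W" "k = position W v"
        using position_image[OF stcw_split] D by blast
      ultimately show ?thesis by (auto simp: points_at_def)
    qed
    have V: "?V \<subseteq> points W" "points_at W A \<subseteq> ?V" "points_at W B \<subseteq> ?V" by (auto simp: points_at_def)
    note ind = induced_induced[OF stcw_split V(2,1)] induced_induced[OF stcw_split V(3,1)]
    show ?thesis
    proof (rule has_split_tree_partition)
      show "is_split_tcw Sig Is (induced W ?V)" by (rule is_split_tcw_induced[OF stcw_split V(1)])
      show "points_at W A \<union> points_at W B = points (induced W ?V)" by (auto simp: points_at_def)
      show "points_at W A \<inter> points_at W B = {}" using union.hyps by (auto simp: points_at_def)
      show "points_at W A \<noteq> {}" "points_at W B \<noteq> {}" using ne sub False by auto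
      show "tc (induced W ?V) I \<subseteq> points_at W A \<times> points_at W A \<union> points_at W B \<times> points_at W B" for I
      proof (rule subrelI)
        fix u v assume uv: "(u, v) \<in> tc (induced W ?V) I"
        then have "(position W u, position W v) \<in> matched_positions W"
          by (auto simp: matched_positions_def)
        then show "(u, v) \<in> points_at W A \<times> points_at W A \<union> points_at W B \<times> points_at W B"
          using uv decomposable_closed[OF union.hyps(1)] decomposable_closed[OF union.hyps(2)]
          by (auto simp: points_at_def)
      qed
      show "card (block_starts (induced (induced W ?V) (points_at W A))) +
          card (block_starts (induced (induced W ?V) (points_at W B))) \<le> K"
        unfolding ind using card_block_starts_le[OF sub(1)] card_block_starts_le[OF sub(2)] union.hyps
        by linarith
      show "has_split_tree Sig Is K (induced (induced W ?V) (points_at W A))"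
        "has_split_tree Sig Is K (induced (induced W ?V) (points_at W B))"
        unfolding ind using union.IH sub False by auto
    qed
  qed
qed simp

lemma split_width_le_decomposable:
  assumes "decomposable K (matched_positions W) {..<card (points W)}" "points W \<noteq> {}" "2 \<le> K"
  shows "split_width Sig Is W \<le> enat K"
proof -
  have "points_at W {..<card (points W)} = points W"
    using position_image[OF stcw_split] by (auto simp: points_at_def)
  moreover have "{..<card (points W)} \<noteq> {}"
    using assms(2) split_tcw_finite[OF stcw_split] by (simp add: lessThan_empty_iff card_eq_0_iff)
  ultimately have "has_split_tree Sig Is K W"
    using has_split_tree_decomposable[OF assms(1) _ _ assms(3)] induced_points[OF stcw_split] by simp
  then show ?thesis by (rule split_width_le)
qed

end

section \<open>Nesting of matching pushes and pops\<close>

lemma pushes_add: "i \<le> j \<Longrightarrow> j \<le> k \<Longrightarrow> pushes ops i k = pushes ops i j + pushes ops j k"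
  unfolding pushes_def by (subst card_Un_disjoint[symmetric]) (auto intro: arg_cong[where f = card])

lemma pops_add: "i \<le> j \<Longrightarrow> j \<le> k \<Longrightarrow> pops ops i k = pops ops i j + pops ops j k"
  unfolding pops_def by (subst card_Un_disjoint[symmetric]) (auto intro: arg_cong[where f = card])

text \<open>If \<open>l\<close> were not before \<open>j\<close>, the stack height would not drop
  from \<open>i\<close> to \<open>k - 1\<close>, rise by one at \<open>k\<close>, and not drop below
  that level up to \<open>j - 1\<close>. But it is the same after \<open>i\<close> and after
  \<open>j - 1\<close>.\<close>

lemma matching_nested:
  assumes ij: "matching ops i j" and kl: "matching ops k l" and k: "i < k" "k < j"
  shows "l < j"
proof (rule ccontr)
  assume "\<not> l < j"
  have one: "card {m'. m - 1 < m' \<and> m' \<le> m \<and> Q m'} = (if Q m then 1 else 0)" if "0 < m"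
    for m :: nat and Q
  proof -
    have "{m'. m - 1 < m' \<and> m' \<le> m \<and> Q m'} = (if Q m then {m} else {})"
      using that by (auto dest: le_antisym)
    then show ?thesis by simp
  qed
  have at_k: "pushes ops (k - 1) k = 1" "pops ops (k - 1) k = 0"
    using kl k unfolding matching_def pushes_def pops_def by (subst one; force)+
  have at_j: "pushes ops (j - 1) j = 0" "pops ops (j - 1) j = 1"
    using ij unfolding matching_def pushes_def pops_def by (subst one; force)+
  have "pops ops k (j - 1) \<le> pushes ops k (j - 1)"
  proof (cases "l = j")
    case True
    then show ?thesis using kl by (simp add: matching_def well_nested_def)
  next
    case False
    then have "pops ops k j \<le> pushes ops k j"
      using kl k \<open>\<not> l < j\<close> by (simp add: matching_def well_nested_def)
    then show ?thesis using pushes_add[of k "j - 1" j ops] pops_add[of k "j - 1" j ops] at_j k by simp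
  qed
  moreover have le: "i \<le> k - 1" "k - 1 \<le> k" "k - 1 \<le> j - 1" "k \<le> j - 1" using k by auto
  then have "pops ops i (k - 1) \<le> pushes ops i (k - 1)" "pops ops i (j - 1) = pushes ops i (j - 1)"
    using ij unfolding matching_def well_nested_def by blast+
  ultimately show False
    using pushes_add[OF le(1,3), of ops] pushes_add[OF le(2,4), of ops]
      pops_add[OF le(1,3), of ops] pops_add[OF le(2,4), of ops] at_k by linarith
qed

section \<open>Positions of the points of a generated word\<close>

locale generated_word =
  fixes Is :: "interval set" and S :: "('s, 'a, 'c, 'x) tpda" and W :: "('v, 'a) split_tcw"
    and n :: nat and d :: "nat \<Rightarrow> ('s, 'a, 'c, 'x) transition" and P :: "'v layout"
    and C :: "'x origin \<Rightarrow> interval \<Rightarrow> ('v \<times> 'v) set"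
  assumes stcw: "is_stcw (alphabet S) Is W"
    and clocks: "finite (clocks S)"
    and factorised: "factorised n d P W"
    and constraints: "constraints_ok S n d P W C"
begin

abbreviation pos :: "'v \<Rightarrow> nat" where
  "pos \<equiv> position W"

text \<open>The index in factor \<open>i\<close> of its first source, counted from
  \<open>lpt P i\<close>. Factor 0 has neither conjunct points nor a letter point.\<close>

definition src_offset :: "nat \<Rightarrow> nat" where
  "src_offset i = (if i = 0 then 1 else length (guard (d i)) + 2)"

lemmas split_word = stcw_split[OF stcw]

lemma length_factor: "length (factor d P i) = src_offset i + num_src P i + 1"
  by (simp add: factor_def src_offset_def)

lemma factor_points: "i \<le> n \<Longrightarrow> v \<in> set (factor d P i) \<Longrightarrow> v \<in> points W"
  using factorised by (auto simp: factorised_def)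

lemma position_factor:
  assumes "i \<le> n" "k < length (factor d P i)"
  shows "pos (factor d P i ! k) = pos (lpt P i) + k"
  using assms(2)
proof (induction k)
  case 0
  then show ?case by (simp add: factor_def)
next
  case (Suc k)
  have "successively (\<lambda>u v. (u, v) \<in> step W) (factor d P i)"
    using factorised assms(1) by (simp add: factorised_def)
  then have "(factor d P i ! k, factor d P i ! Suc k) \<in> step W"
    using Suc.prems by (simp add: successively_conv_nth)
  then have "pos (factor d P i ! Suc k) = Suc (pos (factor d P i ! k))"
    using step_iff_position[OF split_word stcw_hole[OF stcw]] by blast
  then show ?case using Suc by simp
qed

lemma position_nth:
  assumes "i \<le> n" "k < src_offset i + num_src P i + 1" "factor d P i ! k = v"
  shows "v \<in> set (factor d P i) \<and> pos v = pos (lpt P i) + k"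
  using position_factor[OF assms(1), of k] assms nth_mem[of k "factor d P i"] by (auto simp: length_factor)

lemma lpt_in: "i \<le> n \<Longrightarrow> lpt P i \<in> set (factor d P i)"
  by (simp add: factor_def)

lemma position_rpt:
  assumes "i \<le> n"
  shows "rpt P i \<in> set (factor d P i) \<and> pos (rpt P i) = pos (lpt P i) + (src_offset i + num_src P i)"
  by (rule position_nth[OF assms]) (auto simp: factor_def src_offset_def nth_append nth_Cons')

lemma position_spt:
  assumes "i \<le> n" "s < num_src P i"
  shows "spt P i s \<in> set (factor d P i) \<and> pos (spt P i s) = pos (lpt P i) + (src_offset i + s)"
  by (rule position_nth[OF assms(1)]) (use assms in \<open>auto simp: factor_def src_offset_def nth_append nth_Cons'\<close>)

lemma position_cpt:
  assumes "1 \<le> i" "i \<le> n" "t < length (guard (d i))"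
  shows "cpt P i t \<in> set (factor d P i) \<and> pos (cpt P i t) = pos (lpt P i) + (t + 1)"
  by (rule position_nth[OF assms(2)]) (use assms in \<open>auto simp: factor_def src_offset_def nth_append nth_Cons'\<close>)

lemma position_ppt:
  assumes "1 \<le> i" "i \<le> n"
  shows "ppt P i \<in> set (factor d P i) \<and> pos (ppt P i) = pos (lpt P i) + (length (guard (d i)) + 1)"
  by (rule position_nth[OF assms(2)]) (use assms in \<open>auto simp: factor_def src_offset_def nth_append nth_Cons'\<close>)

lemma position_factors_less:
  assumes "i < j" "j \<le> n"
  shows "pos (lpt P i) + src_offset i + num_src P i < pos (lpt P j)"
proof -
  have "(rpt P i, lpt P j) \<in> lt W"
  proof -
    have "set (factor d P i) \<times> set (factor d P j) \<subseteq> lt W"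
      using factorised assms unfolding factorised_def by blast
    then show ?thesis using assms position_rpt[of i] lpt_in[of j] by auto
  qed
  then show ?thesis
    using position_less_iff[OF split_word, of "rpt P i" "lpt P j"] position_rpt[of i] lt_subset[OF split_word] assms
    by auto
qed

definition origin_positions :: "'x origin \<Rightarrow> (nat \<times> nat) set" where
  "origin_positions z = map_prod pos pos ` (\<Union>I. C z I)"

lemma origin_positionsE:
  assumes "(s, t) \<in> origin_positions z"
  obtains u v where "(u, v) \<in> (\<Union>I. C z I)" "s = pos u" "t = pos v"
  using assms unfolding origin_positions_def by auto

lemma matched_positions_eq:
  "matched_positions W = (\<Union>z\<in>{Stack, Zeta} \<union> Clock ` clocks S. origin_positions z)"
proof -
  have tc: "tc W I = (\<Union>z\<in>{Stack, Zeta} \<union> Clock ` clocks S. C z I)" for I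
    using constraints unfolding constraints_ok_def by blast
  have "(\<Union>I. tc W I) = (\<Union>z\<in>{Stack, Zeta} \<union> Clock ` clocks S. \<Union>I. C z I)"
    unfolding tc by (rule SUP_commute)
  then show ?thesis unfolding matched_positions_def origin_positions_def by (simp only: image_UN)
qed

lemma origin_positions_Zeta:
  "origin_positions Zeta \<subseteq> {(pos (lpt P i), pos (lpt P i) + (src_offset i + num_src P i)) | i. i \<le> n}"
proof (rule subrelI)
  fix s t assume "(s, t) \<in> origin_positions Zeta"
  then obtain u v I where uv: "(u, v) \<in> C Zeta I" "s = pos u" "t = pos v"
    by (auto elim: origin_positionsE)
  have "C Zeta = zeta_constraints n P" using constraints by (simp add: constraints_ok_def)
  then obtain i where "i \<le> n" "u = lpt P i" "v = rpt P i"
    using uv(1) by (auto simp: zeta_constraints_def split: if_splits)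
  then show "(s, t) \<in> {(pos (lpt P i), pos (lpt P i) + (src_offset i + num_src P i)) | i. i \<le> n}"
    using uv position_rpt by auto
qed

lemma origin_positions_Stack:
  "origin_positions Stack \<subseteq> {(pos (ppt P i), pos (ppt P j)) | i j. 1 \<le> i \<and> i < j \<and> j \<le> n \<and>
     matching (\<lambda>k. act (d k)) i j}"
proof (rule subrelI)
  fix s t assume "(s, t) \<in> origin_positions Stack"
  then obtain u v I where uv: "(u, v) \<in> C Stack I" "s = pos u" "t = pos v"
    by (auto elim: origin_positionsE)
  have "C Stack = stack_constraints n d P" using constraints by (simp add: constraints_ok_def)
  then obtain i j where "u = ppt P i" "v = ppt P j" "1 \<le> i" "j \<le> n" "matching (\<lambda>k. act (d k)) i j"
    using uv(1) by (auto simp: stack_constraints_def)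
  moreover then have "i < j" by (simp add: matching_def)
  ultimately show "(s, t) \<in> {(pos (ppt P i), pos (ppt P j)) | i j. 1 \<le> i \<and> i < j \<and> j \<le> n \<and>
      matching (\<lambda>k. act (d k)) i j}"
    using uv by blast
qed

text \<open>Vacuously true: \<open>Zeta\<close> constraints of different factors span disjoint
  ranges, so no two of them overlap.\<close>

lemma nested_group_Zeta: "nested_group (origin_positions Zeta)"
proof -
  have False if st: "(s, t) \<in> origin_positions Zeta" "(s', t') \<in> origin_positions Zeta" "s < s'" "s' < t"
    for s t s' t'
  proof -
    obtain i j where "i \<le> n" "s = pos (lpt P i)" "t = pos (lpt P i) + (src_offset i + num_src P i)"
      "j \<le> n" "s' = pos (lpt P j)"
      using st(1,2) origin_positions_Zeta by blast
    then show False
      using st position_factors_less[of i j] position_factors_less[of j i]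
      by (cases i j rule: linorder_cases) auto
  qed
  then show ?thesis unfolding nested_group_def by blast
qed

text \<open>Two overlapping constraints of a clock start in the same factor. Its sources occupy
  consecutive positions, so grouping makes every position in between a source, and the reversed
  order of targets gives the bounds.\<close>

lemma nested_group_Clock:
  assumes x: "x \<in> clocks S"
  shows "nested_group (origin_positions (Clock x))"
  unfolding nested_group_def
proof (intro allI impI)
  let ?C = "\<Union>I. C (Clock x) I"
  have ok: "clock_constraints_ok S n d P W x (C (Clock x))"
    using constraints x by (simp add: constraints_ok_def)
  note ok' = ok[unfolded clock_constraints_ok_def]
  have grouped: "spt P i u \<in> Domain ?C" if "i \<le> n" "s < u" "u < t" "t < num_src P i"
    "spt P i s \<in> Domain ?C" "spt P i t \<in> Domain ?C" for i s u t
    using ok'[THEN conjunct2, THEN conjunct2, THEN conjunct1, rule_format, of i s u t] that by simp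
  have nested: "(v', v) \<in> lt W" if "i \<le> n" "(u, v) \<in> ?C" "(u', v') \<in> ?C"
    "u \<in> set (factor d P i)" "u' \<in> set (factor d P i)" "(u, u') \<in> lt W" for i u v u' v'
    using ok'[THEN conjunct2, THEN conjunct2, THEN conjunct2, rule_format, of i u v u' v'] that by simp
  have edge: "\<exists>i j s t I. u = spt P i s \<and> v = cpt P j t \<and> s < num_src P i \<and> checked S n d i j t x I"
    if uv: "(u, v) \<in> ?C" for u v
  proof -
    obtain I where "(u, v) \<in> C (Clock x) I" using uv by blast
    then have "(u, v) \<in> {(spt P i s, cpt P j t) | i j s t. s < num_src P i \<and> checked S n d i j t x I}"
      using ok'[THEN conjunct2, THEN conjunct1, rule_format, of I] by (rule rev_subsetD)
    then show ?thesis by blast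
  qed
  fix s t s' t' v
  assume *: "(s, t) \<in> origin_positions (Clock x) \<and> (s', t') \<in> origin_positions (Clock x) \<and>
    s < s' \<and> s' < t \<and> s \<le> v \<and> v \<le> s'"
  obtain p q p' q' where pq: "(p, q) \<in> ?C" "(p', q') \<in> ?C" "s = pos p" "t = pos q" "s' = pos p'" "t' = pos q'"
    using * origin_positionsE[of s t] origin_positionsE[of s' t'] by metis
  obtain i j a b I where e: "p = spt P i a" "q = cpt P j b" "a < num_src P i" "checked S n d i j b x I"
    using edge[OF pq(1)] by blast
  obtain i' j' a' b' I' where e': "p' = spt P i' a'" "q' = cpt P j' b'" "a' < num_src P i'"
    "checked S n d i' j' b' x I'"
    using edge[OF pq(2)] by blast
  have ij: "i < j" "j \<le> n" "b < length (guard (d j))" "\<And>k. i < k \<Longrightarrow> k < j \<Longrightarrow> x \<notin> resets_at S d k"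
    using e(4) by (auto simp: checked_def)
  have ij': "i' < j'" "j' \<le> n" "x \<in> resets_at S d i'"
    using e'(4) by (auto simp: checked_def)
  have s: "s = pos (lpt P i) + (src_offset i + a)" and s': "s' = pos (lpt P i') + (src_offset i' + a')"
    and t: "t = pos (lpt P j) + (b + 1)"
    using pq e e' ij ij' position_spt position_cpt by auto
  have "i = i'"
  proof (rule ccontr)
    assume "i \<noteq> i'"
    \<comment> \<open>In turn: the sources would be in the wrong order; the clock would be reset
      between \<open>i\<close> and its check in \<open>j\<close>; the sources of a factor come after
      its conjuncts; the second source would lie in a later factor than \<open>t\<close>.\<close>
    then consider "i' < i" | "i < i'" "i' < j" | "i' = j" | "j < i'" by linarith
    then show False
    proof cases
      case 1
      then show False using position_factors_less[of i' i] * s s' e' ij by simp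
    next
      case 2
      then show False using ij(4) ij'(3) by blast
    next
      case 3
      then show False using * s' t ij by (simp add: src_offset_def)
    next
      case 4
      then show False using position_factors_less[of j i'] * s' t ij ij' by (simp add: src_offset_def)
    qed
  qed
  \<comment> \<open>As \<open>v\<close> lies between the sources number \<open>a\<close> and
    \<open>a'\<close> of factor \<open>i\<close>, it is the position of source number
    \<open>u\<close>.\<close>
  define u where "u = v - (pos (lpt P i) + src_offset i)"
  have v: "v = pos (lpt P i) + (src_offset i + u)" "a \<le> u" "u \<le> a'" "a < a'"
    using * s s' \<open>i = i'\<close> by (auto simp: u_def)
  have lt: "(spt P i k, spt P i l) \<in> lt W" if "k < l" "l < num_src P i" for k l
    using position_less_iff[OF split_word, of "spt P i k" "spt P i l"] position_spt[of i k] position_spt[of i l]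
      factor_points[of i] that ij by simp
  have tgt: "q2 \<in> points W" if "(p2, q2) \<in> ?C" for p2 q2
  proof -
    have "(p2, q2) \<in> (\<Union>I. tc W I)" using that constraints x unfolding constraints_ok_def by auto
    then show ?thesis using tc_points[OF stcw] by blast
  qed
  have ppos: "pos y < pos y'" if "(y, y') \<in> lt W" for y y'
    using that position_less_iff[OF split_word] lt_subset[OF split_word] by blast
  have dom: "spt P i a \<in> Domain ?C" "spt P i a' \<in> Domain ?C"
    using pq e e' \<open>i = i'\<close> by auto
  have a': "a' < num_src P i" using e' \<open>i = i'\<close> by simp
  have "spt P i u \<in> Domain ?C"
    using grouped[of i a u a'] dom v a' ij by (cases "u = a \<or> u = a'") auto
  then obtain w where w: "(spt P i u, w) \<in> ?C" by blast
  have in_factor: "spt P i k \<in> set (factor d P i)" if "k < num_src P i" for k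
    using position_spt[of i k] that ij by simp
  have ends: "u = a \<Longrightarrow> \<exists>w. (spt P i u, w) \<in> ?C \<and> t' \<le> pos w \<and> pos w \<le> t"
  proof (intro exI[of _ q] conjI)
    assume "u = a"
    then show "(spt P i u, q) \<in> ?C" using pq e by simp
    have "(q', q) \<in> lt W"
      using nested[of i p q p' q'] pq e e' \<open>i = i'\<close> lt[of a a'] v a' in_factor ij by simp
    then show "t' \<le> pos q" using ppos pq by (simp add: less_imp_le)
  qed (use pq in simp)
  \<comment> \<open>At either end the given targets \<open>q\<close> and \<open>q'\<close> serve as
    witness. Strictly inside, nesting is applied to the sources \<open>a\<close>, \<open>u\<close>
    and to \<open>u\<close>, \<open>a'\<close>.\<close>
  have "\<exists>w. (spt P i u, w) \<in> ?C \<and> t' \<le> pos w \<and> pos w \<le> t"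
  proof (cases "u = a")
    case False
    then have "(w, q) \<in> lt W"
      using nested[of i p q "spt P i u" w] pq e w lt[of a u] v a' in_factor ij by simp
    then have wt: "pos w \<le> t" using ppos pq by (simp add: less_imp_le)
    show ?thesis
    proof (cases "u = a'")
      case True
      have "(q', q) \<in> lt W"
        using nested[of i p q p' q'] pq e e' \<open>i = i'\<close> lt[of a a'] v a' in_factor ij by simp
      then have "t' \<le> t" using ppos pq by (simp add: less_imp_le)
      then show ?thesis using True pq e' \<open>i = i'\<close> by blast
    next
      case False
      then have "(q', w) \<in> lt W"
        using nested[of i "spt P i u" w p' q'] pq e' \<open>i = i'\<close> w lt[of u a'] v a' in_factor ij by simp
      then have "t' \<le> pos w" using ppos pq by (simp add: less_imp_le)
      then show ?thesis using w wt by blast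
    qed
  qed (rule ends)
  then obtain w' where w': "(spt P i u, w') \<in> ?C" "t' \<le> pos w'" "pos w' \<le> t" by blast
  have "v = pos (spt P i u)" using position_spt[of i u] v a' ij by simp
  then have "(v, pos w') \<in> origin_positions (Clock x)"
    using w'(1) by (force simp: origin_positions_def)
  then show "\<exists>w. (v, w) \<in> origin_positions (Clock x) \<and> t' \<le> w \<and> w \<le> t" using w' by blast
qed

lemma ppt_less:
  assumes "1 \<le> i" "i < j" "j \<le> n"
  shows "pos (ppt P i) < pos (lpt P j)"
  using assms position_ppt[of i] position_factors_less[of i j] by (simp add: src_offset_def)

lemma ppt_less_iff:
  assumes "1 \<le> i" "i \<le> n" "1 \<le> j" "j \<le> n"
  shows "pos (ppt P i) < pos (ppt P j) \<longleftrightarrow> i < j"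
  using assms ppt_less[of i j] ppt_less[of j i] position_ppt[of i] position_ppt[of j]
  by (cases i j rule: linorder_cases) auto

lemma clock_positions: "clock_positions (matched_positions W) (clocks S) origin_positions"
proof (intro clock_positions.intro position_matching[OF stcw] clock_positions_axioms.intro
    clocks matched_positions_eq nested_group_Zeta nested_group_Clock)
  fix s t s' t'
  assume *: "(s, t) \<in> origin_positions Stack" "(s', t') \<in> origin_positions Stack" "s < s'" "s' < t"
  obtain i j k l where ij: "s = pos (ppt P i)" "t = pos (ppt P j)" "1 \<le> i" "i < j" "j \<le> n"
    "matching (\<lambda>k. act (d k)) i j"
    and kl: "s' = pos (ppt P k)" "t' = pos (ppt P l)" "1 \<le> k" "k < l" "l \<le> n"
    "matching (\<lambda>k. act (d k)) k l"
    using *(1,2) origin_positions_Stack by blast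
  then have "l < j" using matching_nested[OF ij(6) kl(6)] *(3,4) ppt_less_iff by simp
  then show "t' < t" using ij kl ppt_less_iff by simp
next
  fix p q assume "(p, q) \<in> origin_positions Stack"
  then obtain i where i: "p = pos (ppt P i)" "1 \<le> i" "i \<le> n"
    using origin_positions_Stack by fastforce
  show "\<exists>c\<le>p. (\<forall>(s, t)\<in>origin_positions Zeta. \<not> (s < c \<and> c \<le> t)) \<and>
      (\<forall>v\<in>Field (origin_positions Stack). \<not> (c \<le> v \<and> v < p))"
  \<comment> \<open>The beginning of the push's factor: a \<open>Zeta\<close> constraint stays
    within one factor and starts at its first point, and a factor has no stack point besides its
    letter point.\<close>
  proof (intro exI[of _ "pos (lpt P i)"] conjI ballI)
    show "pos (lpt P i) \<le> p" using i position_ppt by simp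
    fix e assume "e \<in> origin_positions Zeta"
    then obtain k where k: "e = (pos (lpt P k), pos (lpt P k) + (src_offset k + num_src P k))" "k \<le> n"
      using origin_positions_Zeta by blast
    show "case e of (s, t) \<Rightarrow> \<not> (s < pos (lpt P i) \<and> pos (lpt P i) \<le> t)"
      using k i position_factors_less[of k i] position_factors_less[of i k]
      by (cases k i rule: linorder_cases) auto
  next
    fix v assume "v \<in> Field (origin_positions Stack)"
    then obtain k where k: "v = pos (ppt P k)" "1 \<le> k" "k \<le> n"
      using origin_positions_Stack by (fastforce simp: Field_def)
    show "\<not> (pos (lpt P i) \<le> v \<and> v < p)"
      using ppt_less[of k i] ppt_less_iff[of k i] i k by (cases "k < i") auto
  qed
qed

section \<open>The bounds on the split-width\<close>

lemma points_nonempty: "points W \<noteq> {}"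
  using factor_points[of 0, OF _ lpt_in] by blast

lemma matched_positions_less: "(s, t) \<in> matched_positions W \<Longrightarrow> t < card (points W)"
  using tc_points[OF stcw] position_image[OF split_word] by (fastforce simp: matched_positions_def)

lemma split_width_tpda: "split_width (alphabet S) Is W \<le> enat (4 * card (clocks S) + 6)"
  using clock_positions.decomposable_good[OF clock_positions
      clock_positions.good_interval_all[OF clock_positions matched_positions_less]]
    position_matching.ending_in_all[OF position_matching[OF stcw] matched_positions_less]
  by (intro split_width_le_decomposable[OF stcw] points_nonempty) simp_all

lemma split_width_timed_automaton:
  assumes "\<And>i. 1 \<le> i \<Longrightarrow> i \<le> n \<Longrightarrow> act (d i) = Nop"
  shows "split_width (alphabet S) Is W \<le> enat (card (clocks S) + 4)"
proof -
  \<comment> \<open>A matching needs a push, and all operations are \<open>Nop\<close>.\<close>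
  have "origin_positions Stack = {}"
    using origin_positions_Stack assms by (fastforce simp: matching_def)
  then show ?thesis
    using clock_positions.decomposable_timed_automaton[OF clock_positions, of "card (points W)"]
      position_matching.ending_in_all[OF position_matching[OF stcw] matched_positions_less]
    by (intro split_width_le_decomposable[OF stcw] points_nonempty) simp_all
qed

end

theorem theorem3p4:
  fixes Is :: "interval set"
    and S :: "('s, 'a, 'c, 'x) tpda"
    and W :: "('v, 'a) split_tcw"
  assumes "finite Is" and "(0, 0) \<in> Is"
    and "is_tpda Is S"
    and "W \<in> STCW Is S"
  shows "(is_timed_automaton S \<longrightarrow>
            split_width (alphabet S) Is W \<le> enat (card (clocks S) + 4)) \<and>
         split_width (alphabet S) Is W \<le> enat (4 * card (clocks S) + 6)"
proof -
  obtain n q d P C where run: "is_run S n q d"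
    and *: "factorised n d P W" "constraints_ok S n d P W C" "is_stcw (alphabet S) Is W"
    using assms(4) by (auto simp: STCW_def generated_def)
  interpret generated_word Is S W n d P C
    using * assms(3) by unfold_locales (auto simp: is_tpda_def)
  have "act (d i) = Nop" if "is_timed_automaton S" "1 \<le> i" "i \<le> n" for i
    using run that by (auto simp: is_run_def is_timed_automaton_def)
  then show ?thesis using split_width_timed_automaton split_width_tpda by blast
qed

end
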